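(* (Bienaymé equality) Let $E$ be a $T$-universally complete Riesz space with weak order unit $e=Te$, where $T$ is a strictly positive conditional expectation operator on $E$. If $(f_k)_{k\in\mathbb{N}}$ is a $T$-conditionally independent sequence in $\mathcal{L}^2(T)$, then $$\mathrm{var}\left(\sum_{k=1}^n f_k\right)=\sum_{k=1}^n\mathrm{var}(f_k)$$ for each $n\in\mathbb{N}$.
   Context: A conditional expectation operator on a Dedekind complete Riesz space $E$ with weak order unit is a positive order continuous projection $T:E\to E$ whose range $\mathcal{R}(T)$ is a Dedekind complete Riesz subspace of $E$ and such that $Te$ is a weak order unit of $E$ for each weak order unit $e$ of $E$. $T$ is strictly positive if $f\ge 0$ and $Tf=0$ imply $f=0$. Given a strictly positive conditional expectation operator $T$ on a Dedekind complete Riesz space $E$ with weak order unit, $E$ is called $T$-universally complete if each increasing net $(f_\alpha)$ in $E_+$ for which $(Tf_\alpha)$ is order bounded in the universal completion $E^u$ of $E$ is order convergent in $E$. (A $T$-universally complete space is in particular Dedekind complete.) The universal completion $E^u$ carries its natural $f$-algebra multiplication with multiplicative unit $e$, determined by $(Pe)\cdot(Qe)=PQe$ for band projections $P,Q$. All products and powers are taken in $E^u$. For $E$ $T$-universally complete, $\mathcal{L}^1(T)=E$ and $\mathcal{L}^2(T):=\{x\in\mathcal{L}^1(T) : x^2\in\mathcal{L}^1(T)\}$. $\mathcal{L}^2(T)$ is a vector space and is invariant under $T$. For $f\in\mathcal{L}^2(T)$ the variance is $\mathrm{var}(f):=T\big((f-Tf)^2\big)=T(f^2)-(Tf)^2$.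 $T$-conditional independence: Band projections $P,Q$ on $E$ are $T$-conditionally independent if $TPTQe=TPQe=TQTPe$. Riesz subspaces $E_1,E_2$ of $E$ are $T$-conditionally independent if all band projections $P_1,P_2$ in $E$ with $P_1e\in E_1$, $P_2e\in E_2$ are $T$-conditionally independent. For $A\subset E$, $\langle A\rangle$ denotes the order closed Riesz subspace of $E$ generated by $A$. A family $(E_\lambda)_{\lambda\in\Lambda}$ of closed Dedekind complete Riesz subspaces of $E$, each containing $\mathcal{R}(T)$, is $T$-conditionally independent if for each pair of disjoint sets $\Lambda_1,\Lambda_2\subset\Lambda$ the subspaces $\left\langle\bigcup_{\lambda\in\Lambda_1}E_\lambda\right\rangle$ and $\left\langle\bigcup_{\lambda\in\Lambda_2}E_\lambda\right\rangle$ are $T$-conditionally independent. A sequence $(f_n)$ in $E$ is $T$-conditionally independent if the family $\langle\{f_n\}\cup\mathcal{R}(T)\rangle$, $n\in\mathbb{N}$, is $T$-conditionally independent. *)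

theory Defs
  imports Complex_Main "HOL-Library.Lattice_Algebras"
begin

section \<open>Riesz spaces and f-algebras\<close>

class riesz_space = ordered_real_vector + lattice_ab_group_add_abs

class dedekind_complete_riesz_space = riesz_space + conditionally_complete_lattice

class f_algebra = riesz_space + lattice_ring + real_algebra +
  assumes f_algebra_left: "inf a b = 0 \<Longrightarrow> 0 \<le> c \<Longrightarrow> inf (c * a) b = 0"
    and f_algebra_right: "inf a b = 0 \<Longrightarrow> 0 \<le> c \<Longrightarrow> inf (a * c) b = 0"

text \<open>The unit is not required to differ from zero, so that the zero space is allowed.
  Associativity is part of being a ring; commutativity is not assumed (it is automatic for
  Archimedean f-algebras). Disjoint positive sets need only be assumed bounded above, since
  their suprema then exist by Dedekind completeness.\<close>

class universally_complete_f_algebra =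
  dedekind_complete_riesz_space + f_algebra + monoid_mult +
  assumes laterally_complete:
    "(\<And>x. x \<in> D \<Longrightarrow> 0 \<le> x) \<Longrightarrow>
     (\<And>x y. x \<in> D \<Longrightarrow> y \<in> D \<Longrightarrow> x \<noteq> y \<Longrightarrow> inf x y = 0) \<Longrightarrow> bdd_above D"

section \<open>Order convergence, subspaces, bands\<close>

text \<open>A net in a Riesz space is represented by the filter on the space generated by (the images
  of) its tails. Order convergence of a net depends only on this filter, and every proper filter
  arises from a net. \<open>order_limit F x\<close> says: there is a set \<open>D\<close>, directed downwards with infimum
  zero, such that for each \<open>d \<in> D\<close> the net is eventually within \<open>d\<close> of \<open>x\<close>.\<close>

definition order_limit :: "'a::dedekind_complete_riesz_space filter \<Rightarrow> 'a \<Rightarrow> bool" where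
  "order_limit F x \<longleftrightarrow>
     (\<exists>D. D \<noteq> {} \<and> (\<forall>a\<in>D. \<forall>b\<in>D. \<exists>c\<in>D. c \<le> a \<and> c \<le> b) \<and> (\<forall>d\<in>D. 0 \<le> d) \<and> Inf D = 0 \<and>
          (\<forall>d\<in>D. \<forall>\<^sub>F y in F. \<bar>y - x\<bar> \<le> d))"

definition order_closed :: "'a::dedekind_complete_riesz_space set \<Rightarrow> bool" where
  "order_closed S \<longleftrightarrow>
     (\<forall>F x. F \<noteq> bot \<longrightarrow> eventually (\<lambda>y. y \<in> S) F \<longrightarrow> order_limit F x \<longrightarrow> x \<in> S)"

definition riesz_subspace :: "'a::riesz_space set \<Rightarrow> bool" where
  "riesz_subspace S \<longleftrightarrow> subspace S \<and> (\<forall>x\<in>S. \<forall>y\<in>S. sup x y \<in> S \<and> inf x y \<in> S)"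

text \<open>Suprema are taken within \<open>S\<close>, i.e. \<open>S\<close> is Dedekind complete in its own right.\<close>

definition dedekind_complete_in :: "'a::order set \<Rightarrow> bool" where
  "dedekind_complete_in S \<longleftrightarrow>
     (\<forall>D. D \<noteq> {} \<and> D \<subseteq> S \<and> (\<exists>u\<in>S. \<forall>x\<in>D. x \<le> u) \<longrightarrow>
        (\<exists>s\<in>S. (\<forall>x\<in>D. x \<le> s) \<and> (\<forall>u\<in>S. (\<forall>x\<in>D. x \<le> u) \<longrightarrow> s \<le> u)))"

definition closed_riesz_span :: "'a::dedekind_complete_riesz_space set \<Rightarrow> 'a set" where
  "closed_riesz_span A = \<Inter> {S. riesz_subspace S \<and> order_closed S \<and> A \<subseteq> S}"

definition band :: "'a::dedekind_complete_riesz_space set \<Rightarrow> bool" where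
  "band B \<longleftrightarrow> subspace B \<and> (\<forall>x y. y \<in> B \<longrightarrow> \<bar>x\<bar> \<le> \<bar>y\<bar> \<longrightarrow> x \<in> B) \<and> order_closed B"

definition disjoint_complement :: "'a::riesz_space set \<Rightarrow> 'a set" where
  "disjoint_complement B = {x. \<forall>y\<in>B. inf \<bar>x\<bar> \<bar>y\<bar> = 0}"

definition band_projection :: "('a::dedekind_complete_riesz_space \<Rightarrow> 'a) \<Rightarrow> bool" where
  "band_projection P \<longleftrightarrow>
     (\<exists>B. band B \<and> (\<forall>x. P x \<in> B \<and> x - P x \<in> disjoint_complement B))"

text \<open>The band generated by \<open>e\<close> is the whole space.\<close>

definition weak_order_unit :: "'a::dedekind_complete_riesz_space \<Rightarrow> bool" where
  "weak_order_unit e \<longleftrightarrow> 0 \<le> e \<and> (\<forall>B. band B \<and> e \<in> B \<longrightarrow> B = UNIV)"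

section \<open>Conditional expectation operators\<close>

definition order_continuous :: "('a::dedekind_complete_riesz_space \<Rightarrow> 'a) \<Rightarrow> bool" where
  "order_continuous T \<longleftrightarrow> (\<forall>F x. order_limit F x \<longrightarrow> order_limit (filtermap T F) (T x))"

definition conditional_expectation :: "('a::dedekind_complete_riesz_space \<Rightarrow> 'a) \<Rightarrow> bool" where
  "conditional_expectation T \<longleftrightarrow>
     linear T \<and> (\<forall>x\<ge>0. 0 \<le> T x) \<and> order_continuous T \<and> (\<forall>x. T (T x) = T x) \<and>
     riesz_subspace (range T) \<and> dedekind_complete_in (range T) \<and>
     (\<forall>u. weak_order_unit u \<longrightarrow> weak_order_unit (T u))"

definition strictly_positive :: "('a::riesz_space \<Rightarrow> 'a) \<Rightarrow> bool" where
  "strictly_positive T \<longleftrightarrow> (\<forall>x. 0 \<le> x \<and> T x = 0 \<longrightarrow> x = 0)"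

section \<open>The universal completion\<close>

text \<open>The universal completion is given as a universally complete space together with an
  embedding \<open>j\<close> onto an order dense Riesz subspace. This determines it up to Riesz isomorphism
  over \<open>'a\<close>.\<close>

definition universal_completion ::
    "('a::dedekind_complete_riesz_space \<Rightarrow> 'u::universally_complete_f_algebra) \<Rightarrow> bool" where
  "universal_completion j \<longleftrightarrow>
     linear j \<and> inj j \<and> (\<forall>x y. j (sup x y) = sup (j x) (j y)) \<and>
     (\<forall>x y. j (inf x y) = inf (j x) (j y)) \<and>
     (\<forall>u>0. \<exists>x. 0 < j x \<and> j x \<le> u)"

text \<open>An f-algebra multiplication with unit \<open>j e\<close> is unique. The second condition, its usual
  characterisation on components of \<open>e\<close>, is stated explicitly although the first implies it.\<close>

definition multiplication_normalised_by ::
    "('a::dedekind_complete_riesz_space \<Rightarrow> 'u::universally_complete_f_algebra) \<Rightarrow> 'a \<Rightarrow> bool" where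
  "multiplication_normalised_by j e \<longleftrightarrow>
     j e = 1 \<and>
     (\<forall>P Q. band_projection P \<and> band_projection Q \<longrightarrow> j (P e) * j (Q e) = j (P (Q e)))"

text \<open>The values of an increasing net form an upward directed set. Conversely, such a set \<open>D\<close> is
  an increasing net indexed by itself, and \<open>tail_filter D\<close> is its filter of tails.\<close>

definition tail_filter :: "'a::order set \<Rightarrow> 'a filter" where
  "tail_filter D = (INF d\<in>D. principal {x\<in>D. d \<le> x})"

definition T_universally_complete ::
    "('a::dedekind_complete_riesz_space \<Rightarrow> 'u::universally_complete_f_algebra) \<Rightarrow> ('a \<Rightarrow> 'a) \<Rightarrow> bool"
  where
  "T_universally_complete j T \<longleftrightarrow>
     (\<forall>D. D \<noteq> {} \<and> (\<forall>x\<in>D. 0 \<le> x) \<and> (\<forall>x\<in>D. \<forall>y\<in>D. \<exists>z\<in>D. x \<le> z \<and> y \<le> z) \<and>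
          (\<exists>u. \<forall>x\<in>D. j (T x) \<le> u) \<longrightarrow> (\<exists>x. order_limit (tail_filter D) x))"

definition L2 ::
    "('a::dedekind_complete_riesz_space \<Rightarrow> 'u::universally_complete_f_algebra) \<Rightarrow> 'a set" where
  "L2 j = {x. (j x)\<^sup>2 \<in> range j}"

text \<open>The square is formed in the universal completion and pulled back along \<open>j\<close>. This is
  meaningful for \<open>x \<in> L2 j\<close>, as then also \<open>x - T x \<in> L2 j\<close>.\<close>

definition variance ::
    "('a::dedekind_complete_riesz_space \<Rightarrow> 'u::universally_complete_f_algebra) \<Rightarrow> ('a \<Rightarrow> 'a) \<Rightarrow> 'a \<Rightarrow> 'a"
  where
  "variance j T x = T (inv j ((j (x - T x))\<^sup>2))"

section \<open>Conditional independence\<close>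

definition cond_indep_projections ::
    "'a \<Rightarrow> ('a::dedekind_complete_riesz_space \<Rightarrow> 'a) \<Rightarrow> ('a \<Rightarrow> 'a) \<Rightarrow> ('a \<Rightarrow> 'a) \<Rightarrow> bool" where
  "cond_indep_projections e T P Q \<longleftrightarrow>
     T (P (T (Q e))) = T (P (Q e)) \<and> T (P (Q e)) = T (Q (T (P e)))"

definition cond_indep_subspaces ::
    "'a \<Rightarrow> ('a::dedekind_complete_riesz_space \<Rightarrow> 'a) \<Rightarrow> 'a set \<Rightarrow> 'a set \<Rightarrow> bool" where
  "cond_indep_subspaces e T E1 E2 \<longleftrightarrow>
     (\<forall>P Q. band_projection P \<and> band_projection Q \<and> P e \<in> E1 \<and> Q e \<in> E2 \<longrightarrow>
        cond_indep_projections e T P Q)"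

definition cond_indep_family ::
    "'a \<Rightarrow> ('a::dedekind_complete_riesz_space \<Rightarrow> 'a) \<Rightarrow> 'i set \<Rightarrow> ('i \<Rightarrow> 'a set) \<Rightarrow> bool" where
  "cond_indep_family e T I E \<longleftrightarrow>
     (\<forall>i\<in>I. riesz_subspace (E i) \<and> order_closed (E i) \<and> dedekind_complete_in (E i) \<and>
             range T \<subseteq> E i) \<and>
     (\<forall>I1 I2. I1 \<subseteq> I \<and> I2 \<subseteq> I \<and> I1 \<inter> I2 = {} \<longrightarrow>
        cond_indep_subspaces e T (closed_riesz_span (\<Union>i\<in>I1. E i)) (closed_riesz_span (\<Union>i\<in>I2. E i)))"

text \<open>Sequences are indexed by the positive integers; the value at 0 is irrelevant.\<close>

definition cond_indep_sequence ::
    "'a \<Rightarrow> ('a::dedekind_complete_riesz_space \<Rightarrow> 'a) \<Rightarrow> (nat \<Rightarrow> 'a) \<Rightarrow> bool" where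
  "cond_indep_sequence e T f \<longleftrightarrow>
     cond_indep_family e T {1..} (\<lambda>n. closed_riesz_span ({f n} \<union> range T))"

end

theory Submission
  imports Defs
begin

text \<open>Put \<open>x = f\<^sub>i - T f\<^sub>i\<close> and \<open>y = f\<^sub>k - T f\<^sub>k\<close>. By bilinearity the equality holds once
  \<open>T (x y) = 0\<close> for \<open>i \<noteq> k\<close>. Independence speaks only of components of \<open>e\<close>, the analogues of
  indicator functions: \<open>T (p q) = T ((T p) q)\<close> for a component \<open>p\<close> in the subspace of \<open>f\<^sub>i\<close> and a
  component \<open>q\<close> in that of \<open>f\<^sub>k\<close>. Both sides are linear and continuous in \<open>p\<close>, and components
  span a dense part of an order closed Riesz subspace containing \<open>e\<close>. Hence
  \<open>T (x q) = T ((T x) q)\<close>, which is \<open>0\<close> because \<open>T x = 0\<close> (\<open>indep_component\<close>); approximating \<open>y\<close>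
  by combinations of components \<open>q\<close> then gives \<open>T (x y) = 0\<close> (\<open>indep_uncorrelated\<close>).

  Each such extension is done in two stages. An element bounded by a multiple of \<open>e\<close> is a uniform
  limit of combinations of components, by expanding it in binary digits (\<open>step_approximation\<close>,
  a form of Freudenthal's spectral theorem). A positive \<open>u\<close> is truncated to \<open>inf u (n e)\<close>, and the
  error satisfies \<open>n (u - n e)\<^sup>+ \<le> u\<^sup>2\<close> (\<open>truncation_error\<close>). So the error decreases to \<open>0\<close> at a
  rate governed by one fixed element of the universal completion, also after multiplication by a fixed
  positive factor, and order continuity of \<open>T\<close> applies (\<open>truncation_vanishes\<close>).

  Products live in the universal completion, in which \<open>E\<close> is an ideal (\<open>L_ideal\<close>). Therefore
  \<open>x y\<close> belongs to \<open>E\<close> if \<open>x\<^sup>2\<close> and \<open>y\<^sup>2\<close> do, as \<open>\<bar>x y\<bar> \<le> x\<^sup>2 + y\<^sup>2\<close>. That \<open>(T x)\<^sup>2\<close> belongs to \<open>E\<close> if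
  \<open>x\<^sup>2\<close> does follows from the Jensen type inequality \<open>(T \<bar>x\<bar>)\<^sup>2 \<le> T (x\<^sup>2)\<close> (\<open>square_L_expectation\<close>),
  which rests on the averaging identity \<open>T (r u) = r (T u)\<close> for bounded \<open>r\<close> in the range of \<open>T\<close>.\<close>

section \<open>Lattice arithmetic in Riesz spaces\<close>

lemma scaleR_inf_pos:
  fixes a b :: "'a::riesz_space"
  assumes "0 < c"
  shows "c *\<^sub>R inf a b = inf (c *\<^sub>R a) (c *\<^sub>R b)"
proof (rule antisym)
  show "c *\<^sub>R inf a b \<le> inf (c *\<^sub>R a) (c *\<^sub>R b)"
    using assms by (simp add: scaleR_left_mono)
  have "inverse c *\<^sub>R inf (c *\<^sub>R a) (c *\<^sub>R b) \<le> inverse c *\<^sub>R (c *\<^sub>R a)"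
       "inverse c *\<^sub>R inf (c *\<^sub>R a) (c *\<^sub>R b) \<le> inverse c *\<^sub>R (c *\<^sub>R b)"
    using assms by (intro scaleR_left_mono; simp)+
  then have "inverse c *\<^sub>R inf (c *\<^sub>R a) (c *\<^sub>R b) \<le> inf a b"
    using assms by simp
  then have "c *\<^sub>R (inverse c *\<^sub>R inf (c *\<^sub>R a) (c *\<^sub>R b)) \<le> c *\<^sub>R inf a b"
    using assms by (intro scaleR_left_mono) auto
  then show "inf (c *\<^sub>R a) (c *\<^sub>R b) \<le> c *\<^sub>R inf a b"
    using assms by simp
qed

lemma disjoint_scaleR_left:
  fixes a b :: "'a::riesz_space"
  assumes "inf a b = 0" "0 \<le> c"
  shows "inf (c *\<^sub>R a) b = 0"
proof (rule antisym)
  have ab: "0 \<le> a" "0 \<le> b"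
    using assms(1) by (metis inf_le1, metis inf_le2)
  let ?m = "max c 1"
  have "b = 1 *\<^sub>R b" by simp
  also have "\<dots> \<le> ?m *\<^sub>R b"
    using ab by (intro scaleR_right_mono) auto
  finally have "inf (c *\<^sub>R a) b \<le> inf (?m *\<^sub>R a) (?m *\<^sub>R b)"
    using ab by (intro inf_mono scaleR_right_mono) auto
  also have "\<dots> = 0"
    using assms(1) scaleR_inf_pos[of ?m a b] by simp
  finally show "inf (c *\<^sub>R a) b \<le> 0" .
  show "0 \<le> inf (c *\<^sub>R a) b"
    using ab assms(2) by (simp add: scaleR_nonneg_nonneg)
qed

lemma inf_add_subadditive:
  fixes u v w :: "'a::riesz_space"
  assumes "0 \<le> u" "0 \<le> v" "0 \<le> w"
  shows "inf u (v + w) \<le> inf u v + inf u w"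
proof -
  let ?x = "inf u (v + w)"
  have 1: "?x \<le> u + u" "?x \<le> u + w" "?x \<le> v + u"
    using assms by (auto intro!: le_infI1 simp: add_increasing add_increasing2)
  have "?x \<le> inf (inf (u + u) (v + u)) (inf (u + w) (v + w))"
    using 1 by simp
  also have "\<dots> = inf u v + inf u w"
    by (simp add: add_inf_distrib_left add_inf_distrib_right inf.left_commute inf.assoc inf.commute)
  finally show ?thesis .
qed

lemma diff_inf_eq_pprt:
  fixes x y :: "'a::riesz_space"
  shows "x - inf x y = sup (x - y) 0"
proof -
  have "x - inf x y = x + sup (- x) (- y)"
    by (simp add: neg_inf_eq_sup flip: add_uminus_conv_diff)
  also have "\<dots> = sup (x - y) 0"
    by (simp add: add_sup_distrib_left sup_commute)
  finally show ?thesis .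
qed

lemma abs_scaleR_riesz:
  fixes x :: "'a::riesz_space"
  shows "\<bar>c *\<^sub>R x\<bar> = \<bar>c\<bar> *\<^sub>R \<bar>x\<bar>"
proof -
  have pos: "\<bar>c *\<^sub>R x\<bar> \<le> c *\<^sub>R \<bar>x\<bar>" if "0 \<le> c" for c and x :: 'a
    using that scaleR_left_mono[of "- x" "\<bar>x\<bar>" c]
    by (intro abs_leI) (auto intro: scaleR_left_mono abs_ge_self abs_ge_minus_self)
  have eq: "\<bar>c *\<^sub>R x\<bar> = c *\<^sub>R \<bar>x\<bar>" if c: "0 < c" for c and x :: 'a
  proof (rule antisym)
    have "c *\<^sub>R \<bar>inverse c *\<^sub>R (c *\<^sub>R x)\<bar> \<le> c *\<^sub>R (inverse c *\<^sub>R \<bar>c *\<^sub>R x\<bar>)"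
      using c by (intro scaleR_left_mono pos) auto
    then show "c *\<^sub>R \<bar>x\<bar> \<le> \<bar>c *\<^sub>R x\<bar>" using c by simp
  qed (use c pos in auto)
  have "\<bar>c *\<^sub>R x\<bar> = \<bar>(- c) *\<^sub>R x\<bar>" by (simp add: abs_minus_cancel)
  then show ?thesis
    using eq[of c x] eq[of "- c" x] by (cases c "0::real" rule: linorder_cases) auto
qed

lemma disjoint_pprt_diff:
  fixes x y :: "'a::riesz_space"
  shows "inf (sup (x - y) 0) (sup (y - x) 0) = 0"
proof -
  have "inf (sup (x - y) 0) (sup (y - x) 0) = inf (x - inf x y) (y - inf x y)"
    by (simp add: diff_inf_eq_pprt[symmetric] inf_commute)
  also have "\<dots> = inf x y - inf x y"
    by (simp only: diff_conv_add_uminus add_inf_distrib_right)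
  finally show ?thesis by simp
qed

text \<open>If the multiples of \<open>z\<close> are bounded above, their supremum \<open>s\<close> exists, and \<open>s - z\<close> bounds them as
  well.\<close>

lemma archimedean:
  fixes z w :: "'a::dedekind_complete_riesz_space"
  assumes "\<And>n::nat. real n *\<^sub>R z \<le> w"
  shows "z \<le> 0"
proof -
  have bdd: "bdd_above (range (\<lambda>n. real n *\<^sub>R z))"
    using assms by (intro bdd_aboveI[of _ w]) auto
  have "real n *\<^sub>R z \<le> (SUP n. real n *\<^sub>R z) - z" for n
  proof -
    have "real (Suc n) *\<^sub>R z \<le> (SUP n. real n *\<^sub>R z)"
      by (rule cSUP_upper[OF _ bdd]) simp
    then show ?thesis by (simp add: algebra_simps)
  qed
  then have "(SUP n. real n *\<^sub>R z) \<le> (SUP n. real n *\<^sub>R z) - z"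
    by (intro cSUP_least) auto
  then show ?thesis by simp
qed

lemma archimedean_abs:
  fixes z w :: "'a::dedekind_complete_riesz_space"
  assumes "\<And>\<epsilon>. 0 < \<epsilon> \<Longrightarrow> \<bar>z\<bar> \<le> \<epsilon> *\<^sub>R w"
  shows "z = 0"
proof -
  have w: "0 \<le> w" using order_trans[OF abs_ge_zero assms[of 1]] by simp
  have "real n *\<^sub>R \<bar>z\<bar> \<le> w" for n
  proof (cases "n = 0")
    case False
    have "real n *\<^sub>R \<bar>z\<bar> \<le> real n *\<^sub>R ((1 / real n) *\<^sub>R w)"
      using False by (intro scaleR_left_mono assms) auto
    then show ?thesis using False by simp
  qed (use w in simp)
  then have "\<bar>z\<bar> \<le> 0" by (rule archimedean)
  then show ?thesis by simp
qed

section \<open>Order limits of sequences\<close>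

lemma order_limit_sequenceI:
  fixes g d :: "nat \<Rightarrow> 'a::dedekind_complete_riesz_space"
  assumes dec: "decseq d" and pos: "\<And>n. 0 \<le> d n"
    and inf0: "\<And>z. (\<And>n. z \<le> d n) \<Longrightarrow> z \<le> 0"
    and close: "\<And>n. \<bar>g n - x\<bar> \<le> d n"
  shows "order_limit (filtermap g sequentially) x"
  unfolding order_limit_def
proof (intro exI[of _ "range d"] conjI)
  show "\<forall>a\<in>range d. \<forall>b\<in>range d. \<exists>c\<in>range d. c \<le> a \<and> c \<le> b"
  proof safe
    fix m n
    show "\<exists>c\<in>range d. c \<le> d m \<and> c \<le> d n"
      using dec by (intro bexI[of _ "d (max m n)"]) (auto simp: decseq_def)
  qed
  have "bdd_below (range d)" using pos by (intro bdd_belowI[of _ 0]) auto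
  then show "Inf (range d) = 0"
    using pos by (intro antisym inf0 cINF_greatest) (auto intro: cINF_lower)
  show "\<forall>b\<in>range d. \<forall>\<^sub>F y in filtermap g sequentially. \<bar>y - x\<bar> \<le> b"
  proof safe
    fix m
    have "\<bar>g n - x\<bar> \<le> d m" if "m \<le> n" for n
      using close[of n] dec that by (auto simp: decseq_def intro: order_trans)
    then show "\<forall>\<^sub>F y in filtermap g sequentially. \<bar>y - x\<bar> \<le> d m"
      by (auto simp: eventually_filtermap eventually_sequentially)
  qed
qed (use pos in auto)

lemma order_limit_unique:
  assumes "order_limit F x" "order_limit F y" "F \<noteq> bot"
  shows "x = y"
proof -
  obtain D where D: "D \<noteq> {}" "Inf D = 0" "\<And>d. d \<in> D \<Longrightarrow> \<forall>\<^sub>F z in F. \<bar>z - x\<bar> \<le> d"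
    using assms(1) unfolding order_limit_def by blast
  obtain D' where D': "D' \<noteq> {}" "Inf D' = 0" "\<And>d. d \<in> D' \<Longrightarrow> \<forall>\<^sub>F z in F. \<bar>z - y\<bar> \<le> d"
    using assms(2) unfolding order_limit_def by blast
  have *: "\<bar>x - y\<bar> - d \<le> d'" if "d \<in> D" "d' \<in> D'" for d d'
  proof -
    have "\<forall>\<^sub>F z in F. \<bar>z - x\<bar> \<le> d \<and> \<bar>z - y\<bar> \<le> d'"
      using D(3)[OF that(1)] D'(3)[OF that(2)] by (rule eventually_conj)
    then obtain z where z: "\<bar>z - x\<bar> \<le> d" "\<bar>z - y\<bar> \<le> d'"
      using assms(3) eventually_happens by blast
    have "\<bar>x - y\<bar> \<le> \<bar>x - z\<bar> + \<bar>z - y\<bar>"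
      using abs_triangle_ineq[of "x - z" "z - y"] by simp
    also have "\<dots> \<le> d + d'"
      using z by (intro add_mono) (simp_all add: abs_minus_commute)
    finally show ?thesis by (simp add: algebra_simps)
  qed
  have "\<bar>x - y\<bar> - d \<le> 0" if "d \<in> D" for d
    using cInf_greatest[OF D'(1), of "\<bar>x - y\<bar> - d"] * that D'(2) by auto
  then have "\<bar>x - y\<bar> \<le> 0"
    using cInf_greatest[OF D(1), of "\<bar>x - y\<bar>"] D(2) by auto
  then show ?thesis by simp
qed

text \<open>A lower bound for a net that tends to zero; this is how order continuity of \<open>T\<close> is exploited.\<close>

lemma order_limit_zero_dominates:
  assumes "order_limit F 0" "F \<noteq> bot" "\<forall>\<^sub>F y in F. \<bar>z\<bar> \<le> \<bar>y\<bar>"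
  shows "z = 0"
proof -
  obtain D where D: "D \<noteq> {}" "Inf D = 0" "\<And>d. d \<in> D \<Longrightarrow> \<forall>\<^sub>F y in F. \<bar>y\<bar> \<le> d"
    using assms(1) unfolding order_limit_def diff_0_right by blast
  have "\<bar>z\<bar> \<le> d" if d: "d \<in> D" for d
  proof -
    have "\<forall>\<^sub>F y in F. \<bar>z\<bar> \<le> \<bar>y\<bar> \<and> \<bar>y\<bar> \<le> d"
      using assms(3) D(3)[OF d] by (rule eventually_conj)
    then obtain y where "\<bar>z\<bar> \<le> \<bar>y\<bar>" "\<bar>y\<bar> \<le> d"
      using assms(2) eventually_happens by blast
    then show ?thesis by (rule order_trans)
  qed
  then have "\<bar>z\<bar> \<le> 0" using cInf_greatest[OF D(1), of "\<bar>z\<bar>"] D(2) by auto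
  then show ?thesis by simp
qed

lemma order_closed_SUP:
  fixes g :: "nat \<Rightarrow> 'a::dedekind_complete_riesz_space"
  assumes "order_closed S" "incseq g" "\<And>n. g n \<in> S" "bdd_above (range g)"
  shows "(SUP n. g n) \<in> S"
proof -
  let ?s = "SUP n. g n"
  have up: "g n \<le> ?s" for n
    using assms(4) by (intro cSUP_upper) auto
  have "order_limit (filtermap g sequentially) ?s"
  proof (rule order_limit_sequenceI[where d = "\<lambda>n. ?s - g n"])
    show "decseq (\<lambda>n. ?s - g n)"
      using assms(2) by (auto simp: decseq_def incseq_def)
    fix z assume "\<And>n. z \<le> ?s - g n"
    then have "g n \<le> ?s - z" for n by (simp add: le_diff_eq add.commute)
    then have "?s \<le> ?s - z" by (intro cSUP_least) auto
    then show "z \<le> 0" by simp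
  qed (use up in \<open>auto simp: abs_minus_commute[of _ ?s]\<close>)
  moreover have "filtermap g sequentially \<noteq> bot" by (simp add: filtermap_bot_iff)
  moreover have "\<forall>\<^sub>F y in filtermap g sequentially. y \<in> S"
    using assms(3) by (simp add: eventually_filtermap)
  ultimately show ?thesis
    using assms(1) unfolding order_closed_def by blast
qed

text \<open>Order closedness holds because \<open>inf \<bar>x\<bar> \<bar>a\<bar> \<le> inf \<bar>y\<bar> \<bar>a\<bar> + \<bar>x - y\<bar>\<close>, whose first summand vanishes
  for the \<open>y\<close> in the complement.\<close>

lemma band_disjoint_complement:
  fixes A :: "'a::dedekind_complete_riesz_space set"
  shows "band (disjoint_complement A)"
  unfolding band_def
proof (intro conjI allI impI)
  show "subspace (disjoint_complement A)"
  proof (rule subspaceI)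
    fix x y assume xy: "x \<in> disjoint_complement A" "y \<in> disjoint_complement A"
    show "x + y \<in> disjoint_complement A"
      unfolding disjoint_complement_def
    proof safe
      fix a assume a: "a \<in> A"
      have "inf (\<bar>x + y\<bar>) (\<bar>a\<bar>) \<le> inf (\<bar>a\<bar>) (\<bar>x\<bar> + \<bar>y\<bar>)"
        by (simp add: abs_triangle_ineq le_infI1)
      also have "\<dots> \<le> inf (\<bar>a\<bar>) (\<bar>x\<bar>) + inf (\<bar>a\<bar>) (\<bar>y\<bar>)"
        by (rule inf_add_subadditive) auto
      also have "\<dots> = 0" using xy a by (simp add: disjoint_complement_def inf_commute)
      finally show "inf (\<bar>x + y\<bar>) (\<bar>a\<bar>) = 0" by (simp add: antisym)
    qed
  next
    fix c x assume "x \<in> disjoint_complement A"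
    then show "c *\<^sub>R x \<in> disjoint_complement A"
      by (auto simp: disjoint_complement_def abs_scaleR_riesz intro!: disjoint_scaleR_left)
  qed (simp add: disjoint_complement_def inf_absorb1)
next
  fix x y assume "y \<in> disjoint_complement A" "\<bar>x\<bar> \<le> \<bar>y\<bar>"
  then have "inf (\<bar>x\<bar>) (\<bar>a\<bar>) \<le> 0" if "a \<in> A" for a
    using that inf_mono[of "\<bar>x\<bar>" "\<bar>y\<bar>" "\<bar>a\<bar>" "\<bar>a\<bar>"] by (auto simp: disjoint_complement_def)
  then show "x \<in> disjoint_complement A"
    by (simp add: disjoint_complement_def antisym)
next
  show "order_closed (disjoint_complement A)"
    unfolding order_closed_def
  proof (intro allI impI)
    fix F x
    assume F: "F \<noteq> bot" "\<forall>\<^sub>F y in F. y \<in> disjoint_complement A" "order_limit F x"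
    obtain D where D: "D \<noteq> {}" "Inf D = 0" "\<And>d. d \<in> D \<Longrightarrow> \<forall>\<^sub>F y in F. \<bar>y - x\<bar> \<le> d"
      using F(3) unfolding order_limit_def by blast
    show "x \<in> disjoint_complement A"
      unfolding disjoint_complement_def
    proof safe
      fix a assume a: "a \<in> A"
      have "inf (\<bar>x\<bar>) (\<bar>a\<bar>) \<le> d" if d: "d \<in> D" for d
      proof -
        have "\<forall>\<^sub>F y in F. y \<in> disjoint_complement A \<and> \<bar>y - x\<bar> \<le> d"
          using F(2) D(3)[OF d] by (rule eventually_conj)
        then obtain y where y: "y \<in> disjoint_complement A" "\<bar>y - x\<bar> \<le> d"
          using F(1) eventually_happens by blast
        have "\<bar>x\<bar> \<le> \<bar>y\<bar> + \<bar>x - y\<bar>"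
          using abs_triangle_ineq[of y "x - y"] by simp
        then have "inf (\<bar>x\<bar>) (\<bar>a\<bar>) \<le> inf (\<bar>a\<bar>) (\<bar>y\<bar> + \<bar>x - y\<bar>)"
          by (simp add: le_infI1)
        also have "\<dots> \<le> inf (\<bar>a\<bar>) (\<bar>y\<bar>) + inf (\<bar>a\<bar>) (\<bar>x - y\<bar>)"
          by (rule inf_add_subadditive) auto
        also have "\<dots> \<le> d"
          using y a by (simp add: disjoint_complement_def inf_commute abs_minus_commute le_infI1 le_infI2)
        finally show ?thesis .
      qed
      then have "inf (\<bar>x\<bar>) (\<bar>a\<bar>) \<le> 0"
        using cInf_greatest[OF D(1), of "inf (\<bar>x\<bar>) (\<bar>a\<bar>)"] D(2) by auto
      then show "inf (\<bar>x\<bar>) (\<bar>a\<bar>) = 0" by (simp add: antisym)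
    qed
  qed
qed

section \<open>Components of the unit\<close>

definition components :: "'a::riesz_space \<Rightarrow> 'a set" where
  "components e = {p. inf p (e - p) = 0}"

lemma components_bounds:
  assumes "p \<in> components e"
  shows "0 \<le> p" "p \<le> e"
  using assms unfolding components_def
  by (metis (mono_tags) inf_le1 mem_Collect_eq, metis (mono_tags, lifting) diff_ge_0_iff_ge inf_le2 mem_Collect_eq)

text \<open>The component \<open>p\<close> plays the role of the indicator function of the set where \<open>a\<close> is positive. It
  stays in every order closed Riesz subspace that contains \<open>a\<close> and \<open>e\<close>.\<close>

lemma support_component:
  fixes a e :: "'a::dedekind_complete_riesz_space"
  assumes "0 \<le> a" "0 \<le> e"
  defines "p \<equiv> SUP n::nat. inf (real n *\<^sub>R a) e"
  shows "p \<in> components e" and "\<And>n. inf (real n *\<^sub>R a) e \<le> p"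
    and "\<And>z. (\<And>n. inf (real n *\<^sub>R a) e \<le> z) \<Longrightarrow> p \<le> z"
    and "\<lbrakk>riesz_subspace S; order_closed S; a \<in> S; e \<in> S\<rbrakk> \<Longrightarrow> p \<in> S"
proof -
  let ?g = "\<lambda>n::nat. inf (real n *\<^sub>R a) e"
  have bdd: "bdd_above (range ?g)" by (intro bdd_aboveI[of _ e]) auto
  show up: "?g n \<le> p" for n
    unfolding p_def by (rule cSUP_upper[OF _ bdd]) simp
  show least: "p \<le> z" if "\<And>n. ?g n \<le> z" for z
    unfolding p_def using that by (intro cSUP_least) auto
  have p0: "0 \<le> p" using up[of 0] assms(2) by (simp add: inf_absorb1)
  have pe: "p \<le> e" by (rule least) simp
  let ?d = "inf p (e - p)"
  have d: "0 \<le> ?d" "?d \<le> p" "?d + p \<le> e"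
    using p0 pe by (auto simp: le_diff_eq[symmetric])
  \<comment> \<open>Adding \<open>inf a ?d\<close> to \<open>?g n\<close> does not lead above \<open>?g (n + 1)\<close>, so \<open>inf a ?d\<close> is zero.
    Then \<open>?d\<close> is disjoint from every \<open>?g n\<close>, hence can be added to all of them below \<open>p\<close>.\<close>
  have "?g n \<le> p - inf a ?d" for n
  proof -
    have "inf a ?d + ?g n \<le> a + real n *\<^sub>R a" by (intro add_mono) auto
    moreover have "inf a ?d + ?g n \<le> ?d + p" by (rule add_mono[OF inf_le2 up])
    ultimately have "inf a ?d + ?g n \<le> ?g (Suc n)"
      using d(3) by (auto simp: algebra_simps intro: order_trans)
    then have "inf a ?d + ?g n \<le> p" using up by (rule order_trans)
    then show ?thesis by (simp only: le_diff_eq add.commute)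
  qed
  then have "p \<le> p - inf a ?d" by (rule least)
  then have "inf a ?d \<le> 0" by (simp only: le_diff_eq add_le_same_cancel1)
  then have "inf a ?d = 0" using assms(1) d(1) by (intro antisym) simp_all
  then have "inf (real n *\<^sub>R a) ?d = 0" for n by (rule disjoint_scaleR_left) simp
  then have disj: "inf (?g n) ?d = 0" for n
    using d(1) assms(1,2) 
    by (metis (no_types, lifting) antisym inf.assoc inf.commute inf_le2 inf_absorb2)
  \<comment> \<open>Disjoint elements have their sum as supremum.\<close>
  have "?g n \<le> p - ?d" for n
  proof -
    have "?g n + ?d = sup (?g n) ?d + inf (?g n) ?d"
      by (metis add_eq_inf_sup add.commute)
    then have "?g n + ?d \<le> p" using disj[of n] up[of n] d(2) by simp
    then show ?thesis by (simp only: le_diff_eq)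
  qed
  then have "p \<le> p - ?d" by (rule least)
  then have "?d \<le> 0" by (simp only: le_diff_eq add_le_same_cancel1)
  then show "p \<in> components e" using d(1) by (simp add: components_def antisym del: le_inf_iff)
  show "p \<in> S" if S: "riesz_subspace S" "order_closed S" "a \<in> S" "e \<in> S"
    unfolding p_def
  proof (rule order_closed_SUP[OF S(2) _ _ bdd])
    show "incseq ?g"
      using assms(1) by (intro incseq_SucI inf_mono scaleR_right_mono) auto
    show "?g n \<in> S" for n
      using S unfolding riesz_subspace_def by (simp add: subspace_scale)
  qed
qed

text \<open>One step of a greedy binary expansion: \<open>p\<close> is the indicator of the set where \<open>y > c e\<close>, and
  removing \<open>c p\<close> halves the bound on \<open>y\<close>.\<close>

lemma binary_digit:
  fixes y e :: "'a::dedekind_complete_riesz_space"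
  assumes S: "riesz_subspace S" "order_closed S" "e \<in> S" "y \<in> S"
    and e: "0 \<le> e" and c: "0 < c" and y: "0 \<le> y" "y \<le> (2 * c) *\<^sub>R e"
  obtains p where "p \<in> S" "p \<in> components e" "c *\<^sub>R p \<le> y" "y - c *\<^sub>R p \<le> c *\<^sub>R e"
proof -
  define a where "a = sup (y - c *\<^sub>R e) 0"
  define b where "b = sup (c *\<^sub>R e - y) 0"
  define p where "p = (SUP n::nat. inf (real n *\<^sub>R a) e)"
  have a: "0 \<le> a" by (simp add: a_def)
  have b: "0 \<le> b" by (simp add: b_def)
  have "a \<in> S"
    using S unfolding riesz_subspace_def a_def by (simp add: subspace_scale subspace_diff subspace_0)
  then have p: "p \<in> S" "p \<in> components e"
    unfolding p_def using support_component(1,4)[OF a e] S by auto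
  have ab: "inf a b = 0" unfolding a_def b_def by (rule disjoint_pprt_diff)
  have "p \<le> (1 / c) *\<^sub>R y"
    unfolding p_def
  proof (rule support_component(3)[OF a e])
    fix n
    have ce: "c *\<^sub>R e = inf (c *\<^sub>R e) y + b"
      using diff_inf_eq_pprt[of "c *\<^sub>R e" y] unfolding b_def by (metis add.commute diff_add_cancel)
    have "e = (1 / c) *\<^sub>R (c *\<^sub>R e)" using c by simp
    also have "\<dots> = (1 / c) *\<^sub>R inf (c *\<^sub>R e) y + (1 / c) *\<^sub>R b"
      by (subst ce) (simp add: scaleR_add_right)
    finally have "inf (real n *\<^sub>R a) e
        = inf (real n *\<^sub>R a) ((1 / c) *\<^sub>R inf (c *\<^sub>R e) y + (1 / c) *\<^sub>R b)"
      by simp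
    also have "\<dots> \<le> inf (real n *\<^sub>R a) ((1 / c) *\<^sub>R inf (c *\<^sub>R e) y) + inf (real n *\<^sub>R a) ((1 / c) *\<^sub>R b)"
      using a b c e y(1) by (intro inf_add_subadditive) (simp_all add: scaleR_nonneg_nonneg)
    also have "inf (real n *\<^sub>R a) ((1 / c) *\<^sub>R b) = 0"
      using ab c disjoint_scaleR_left[of b "real n *\<^sub>R a" "1 / c"] disjoint_scaleR_left[of a b "real n"]
      by (simp add: inf_commute)
    also have "inf (real n *\<^sub>R a) ((1 / c) *\<^sub>R inf (c *\<^sub>R e) y) \<le> (1 / c) *\<^sub>R y"
      using c by (intro le_infI2 scaleR_left_mono) auto
    finally show "inf (real n *\<^sub>R a) e \<le> (1 / c) *\<^sub>R y" by simp
  qed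
  then have "c *\<^sub>R p \<le> c *\<^sub>R ((1 / c) *\<^sub>R y)" using c by (intro scaleR_left_mono) auto
  then have 1: "c *\<^sub>R p \<le> y" using c by simp
  have "a \<le> c *\<^sub>R e"
    using y(2) c e by (simp add: a_def scaleR_nonneg_nonneg scaleR_2 algebra_simps flip: scaleR_scaleR)
  then have "(1 / c) *\<^sub>R a \<le> (1 / c) *\<^sub>R (c *\<^sub>R e)" using c by (intro scaleR_left_mono) auto
  then have ae: "(1 / c) *\<^sub>R a \<le> e" using c by simp
  \<comment> \<open>Since \<open>a \<le> c e\<close>, already one of the terms with supremum \<open>p\<close> dominates \<open>(1 / c) a\<close>.\<close>
  obtain n :: nat where "1 / c \<le> real n" using real_arch_simple by blast
  then have "(1 / c) *\<^sub>R a \<le> real n *\<^sub>R a" using a by (intro scaleR_right_mono) auto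
  with ae have "(1 / c) *\<^sub>R a \<le> inf (real n *\<^sub>R a) e" by simp
  also have "\<dots> \<le> p" unfolding p_def by (rule support_component(2)[OF a e])
  finally have "c *\<^sub>R ((1 / c) *\<^sub>R a) \<le> c *\<^sub>R p" using c by (intro scaleR_left_mono) auto
  then have "a \<le> c *\<^sub>R p" using c by simp
  moreover have "y - c *\<^sub>R e \<le> a" by (simp add: a_def)
  ultimately have "y - c *\<^sub>R e \<le> c *\<^sub>R p" by (rule order_trans[rotated])
  then have "y - c *\<^sub>R p \<le> c *\<^sub>R e" by (simp add: algebra_simps)
  with p 1 show thesis by (rule that)
qed

lemma binary_expansion:
  fixes y e :: "'a::dedekind_complete_riesz_space"
  assumes S: "riesz_subspace S" "order_closed S" "e \<in> S" "y \<in> S"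
    and e: "0 \<le> e" and c: "0 < c" and y: "0 \<le> y" "y \<le> c *\<^sub>R e"
  shows "\<exists>s \<in> span (S \<inter> components e). 0 \<le> y - s \<and> y - s \<le> (c / 2 ^ m) *\<^sub>R e"
proof (induction m)
  case 0
  show ?case using y by (intro bexI[of _ 0]) (auto simp: span_zero)
next
  case (Suc m)
  then obtain s where s: "s \<in> span (S \<inter> components e)" "0 \<le> y - s" "y - s \<le> (c / 2 ^ m) *\<^sub>R e"
    by blast
  have "span (S \<inter> components e) \<subseteq> S"
    using S(1) by (intro span_minimal) (auto simp: riesz_subspace_def)
  then have "y - s \<in> S"
    using S s(1) by (auto simp: riesz_subspace_def intro: subspace_diff)
  moreover have "y - s \<le> (2 * (c / 2 ^ Suc m)) *\<^sub>R e" using s(3) by simp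
  ultimately obtain p where p: "p \<in> S" "p \<in> components e"
    "(c / 2 ^ Suc m) *\<^sub>R p \<le> y - s" "y - s - (c / 2 ^ Suc m) *\<^sub>R p \<le> (c / 2 ^ Suc m) *\<^sub>R e"
    using binary_digit[OF S(1-3) _ e _ s(2)] c by (metis divide_pos_pos zero_less_numeral zero_less_power)
  have "s + (c / 2 ^ Suc m) *\<^sub>R p \<in> span (S \<inter> components e)"
    using s(1) p(1,2) by (intro span_add span_scale) (auto intro: span_base)
  then show ?case
    using p(3,4) by (intro bexI[of _ "s + (c / 2 ^ Suc m) *\<^sub>R p"]) (auto simp: algebra_simps)
qed

text \<open>A uniform version of Freudenthal's spectral theorem, relative to an order closed Riesz subspace: the
  components used may be taken in the subspace.\<close>

theorem step_approximation:
  fixes y e :: "'a::dedekind_complete_riesz_space"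
  assumes S: "riesz_subspace S" "order_closed S" "e \<in> S" "y \<in> S"
    and e: "0 \<le> e" and y: "\<bar>y\<bar> \<le> c *\<^sub>R e" and \<epsilon>: "0 < \<epsilon>"
  shows "\<exists>s \<in> span (S \<inter> components e). \<bar>y - s\<bar> \<le> \<epsilon> *\<^sub>R e"
proof -
  define C where "C = max c 1"
  have "\<bar>y\<bar> \<le> C *\<^sub>R e"
    by (rule order_trans[OF y scaleR_right_mono[OF _ e]]) (simp add: C_def)
  then have yC: "y \<le> C *\<^sub>R e" "- y \<le> C *\<^sub>R e" by (auto intro: order_trans abs_ge_self abs_ge_minus_self)
  \<comment> \<open>Shifting by a multiple of the unit makes \<open>y\<close> positive.\<close>
  have 1: "y + C *\<^sub>R e \<in> S" using S by (auto simp: riesz_subspace_def intro: subspace_add subspace_scale)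
  have 2: "0 \<le> y + C *\<^sub>R e" using yC(2) by (metis add.commute diff_0 diff_le_eq)
  have 3: "y + C *\<^sub>R e \<le> (2 * C) *\<^sub>R e"
    using yC(1) by (simp add: scaleR_2 flip: scaleR_scaleR)
  obtain m where m: "2 * C / \<epsilon> < 2 ^ m" using real_arch_pow[of 2] by auto
  have "0 < 2 * C" by (simp add: C_def)
  then obtain s where s: "s \<in> span (S \<inter> components e)" "0 \<le> y + C *\<^sub>R e - s"
      "y + C *\<^sub>R e - s \<le> (2 * C / 2 ^ m) *\<^sub>R e"
    using binary_expansion[OF S(1-3) 1 e _ 2 3] by blast
  have "e \<in> components e" using e by (simp add: components_def inf_absorb2)
  then have "s - C *\<^sub>R e \<in> span (S \<inter> components e)"
    using s(1) S(3) by (intro span_diff span_scale) (auto intro: span_base)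
  moreover have "\<bar>y - (s - C *\<^sub>R e)\<bar> \<le> \<epsilon> *\<^sub>R e"
  proof -
    have "2 * C / 2 ^ m \<le> \<epsilon>" using m \<epsilon> by (simp add: field_simps)
    then have "(2 * C / 2 ^ m) *\<^sub>R e \<le> \<epsilon> *\<^sub>R e" using e by (rule scaleR_right_mono)
    moreover have "y - (s - C *\<^sub>R e) = y + C *\<^sub>R e - s" by simp
    ultimately show ?thesis using s(2,3) by (metis abs_of_nonneg order_trans)
  qed
  ultimately show ?thesis by blast
qed

section \<open>Products in f-algebras\<close>

lemma disjoint_mult_zero:
  fixes a b :: "'a::f_algebra"
  assumes "inf a b = 0"
  shows "a * b = 0"
proof -
  have ab: "0 \<le> a" "0 \<le> b"
    using assms by (metis inf_le1, metis inf_le2)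
  have "inf b (a * b) = 0"
    using f_algebra_right[OF assms ab(2)] by (simp add: inf_commute)
  from f_algebra_left[OF this ab(1)] show ?thesis by simp
qed

lemma pprt_nprt_decomp:
  fixes a :: "'a::riesz_space"
  shows "a = sup a 0 - sup (- a) 0" "\<bar>a\<bar> = sup a 0 + sup (- a) 0"
    "inf (sup a 0) (sup (- a) 0) = 0" "0 \<le> sup a 0" "0 \<le> sup (- a) 0"
proof -
  show 1: "a = sup a 0 - sup (- a) 0"
    using prts[of a] by (simp add: pprt_def nprt_def neg_sup_eq_inf)
  show "\<bar>a\<bar> = sup a 0 + sup (- a) 0"
    using abs_prts[of a] by (simp add: pprt_def nprt_def neg_inf_eq_sup)
  show "inf (sup a 0) (sup (- a) 0) = 0"
    using disjoint_pprt_diff[of a 0] by simp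
qed simp_all

lemma square_eq_pprt:
  fixes a :: "'a::f_algebra"
  shows "a * a = sup a 0 * sup a 0 + sup (- a) 0 * sup (- a) 0" "\<bar>a\<bar> * \<bar>a\<bar> = a * a"
proof -
  define P N where "P = sup a 0" and "N = sup (- a) 0"
  have d: "a = P - N" "\<bar>a\<bar> = P + N" "inf P N = 0"
    unfolding P_def N_def by (rule pprt_nprt_decomp)+
  have z: "P * N = 0" "N * P = 0"
    using disjoint_mult_zero[OF d(3)] disjoint_mult_zero[OF d(3)[unfolded inf_commute[of P]]]
    by auto
  have 1: "a * a = P * P + N * N"
    unfolding d(1) by (simp add: left_diff_distrib right_diff_distrib z)
  then show "a * a = sup a 0 * sup a 0 + sup (- a) 0 * sup (- a) 0"
    unfolding P_def N_def .
  show "\<bar>a\<bar> * \<bar>a\<bar> = a * a"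
    unfolding d(2) 1 by (simp add: distrib_left distrib_right z)
qed

text \<open>The positive and the negative part of \<open>a\<close> multiply to zero, so \<open>a\<^sup>2\<close> is the sum of their squares.\<close>

lemma square_nonneg:
  fixes a :: "'a::f_algebra"
  shows "0 \<le> a * a"
  by (subst square_eq_pprt(1)) (simp add: add_nonneg_nonneg mult_nonneg_nonneg)

lemma mult_commutator_le_squares:
  fixes a b :: "'a::f_algebra"
  shows "a * b + b * a \<le> a * a + b * b"
  using square_nonneg[of "a - b"] by (simp add: algebra_simps)

text \<open>Expand \<open>(a - b)\<^sup>2 \<ge> 0\<close> and drop the positive term \<open>b a\<close>.\<close>

lemma mult_le_squares:
  fixes a b :: "'a::f_algebra"
  assumes "0 \<le> a" "0 \<le> b"
  shows "a * b \<le> a * a + b * b"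
proof -
  have "a * b + 0 \<le> a * b + b * a" using assms by (intro add_left_mono) auto
  also have "\<dots> \<le> a * a + b * b" by (rule mult_commutator_le_squares)
  finally show ?thesis by simp
qed

lemma one_nonneg: "0 \<le> (1::'a::universally_complete_f_algebra)"
  using square_nonneg[of "1::'a"] by simp

text \<open>For \<open>u \<ge> 0\<close> both \<open>p u\<close> and \<open>u p\<close> are disjoint from \<open>1 - p\<close>, whence \<open>p u = p u p = u p\<close>.\<close>

lemma components_one_commute:
  fixes p u :: "'a::universally_complete_f_algebra"
  assumes p: "p \<in> components 1"
  shows "p * u = u * p"
proof -
  have pq: "inf p (1 - p) = 0" using p by (simp add: components_def)
  have *: "p * u = u * p" if "0 \<le> u" for u
  proof -
    have "p * u * (1 - p) = 0"
      using f_algebra_right[OF pq that] by (rule disjoint_mult_zero)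
    then have "p * u = p * u * p" by (simp add: right_diff_distrib)
    moreover have "inf (1 - p) (u * p) = 0"
      using f_algebra_left[OF pq that] by (simp only: inf_commute)
    then have "(1 - p) * (u * p) = 0" by (rule disjoint_mult_zero)
    then have "u * p = p * u * p" by (simp add: left_diff_distrib mult.assoc)
    ultimately show ?thesis by simp
  qed
  obtain P N where "u = P - N" "0 \<le> P" "0 \<le> N"
    using pprt_nprt_decomp[of u] by blast
  then show ?thesis
    using *[of P] *[of N] by (simp add: left_diff_distrib right_diff_distrib)
qed

lemma components_one_idem:
  fixes p :: "'a::universally_complete_f_algebra"
  assumes "p \<in> components 1"
  shows "p * p = p" "(1 - p) * p = 0"
proof -
  have pq: "inf p (1 - p) = 0" using assms by (simp add: components_def)
  show "p * p = p" using disjoint_mult_zero[OF pq] by (simp add: right_diff_distrib)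
  then show "(1 - p) * p = 0" by (simp add: left_diff_distrib)
qed

text \<open>With \<open>g = (u - n)\<^sup>+\<close> one has \<open>g (u - n) = g\<^sup>2 \<ge> 0\<close>, so \<open>n g \<le> g u \<le> u\<^sup>2\<close>. This quantitative bound takes
  the place of order continuity of the multiplication.\<close>

lemma truncation_error:
  fixes u :: "'a::universally_complete_f_algebra"
  assumes "0 \<le> u"
  shows "real n *\<^sub>R sup (u - real n *\<^sub>R 1) 0 \<le> u * u" "sup (u - real n *\<^sub>R 1) 0 \<le> u"
proof -
  let ?v = "u - real n *\<^sub>R 1" let ?g = "sup ?v 0"
  show gu: "?g \<le> u"
    using assms by (simp add: scaleR_nonneg_nonneg one_nonneg)
  obtain h where d: "?v = ?g - h" "inf ?g h = 0"
    using pprt_nprt_decomp[of ?v] by blast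
  have "?g * ?v = ?g * ?g"
    using d(1) disjoint_mult_zero[OF d(2)] by (metis diff_0_right right_diff_distrib)
  then have "0 \<le> ?g * ?v" using square_nonneg[of ?g] by simp
  moreover have "?g * ?v = ?g * u - real n *\<^sub>R ?g"
    by (simp only: right_diff_distrib mult_scaleR_right mult_1_right)
  ultimately have "real n *\<^sub>R ?g \<le> ?g * u" by simp
  also have "\<dots> \<le> u * u" using gu assms by (rule mult_right_mono)
  finally show "real n *\<^sub>R ?g \<le> u * u" .
qed

lemma abs_mult_bounded:
  fixes u v :: "'a::universally_complete_f_algebra"
  assumes "\<bar>v\<bar> \<le> c *\<^sub>R 1"
  shows "\<bar>u * v\<bar> \<le> c *\<^sub>R \<bar>u\<bar>" "\<bar>v * u\<bar> \<le> c *\<^sub>R \<bar>u\<bar>"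
proof -
  have "\<bar>u * v\<bar> \<le> \<bar>u\<bar> * \<bar>v\<bar>" by (rule abs_le_mult)
  also have "\<dots> \<le> \<bar>u\<bar> * (c *\<^sub>R 1)" using assms by (rule mult_left_mono) simp
  finally show "\<bar>u * v\<bar> \<le> c *\<^sub>R \<bar>u\<bar>" by simp
  have "\<bar>v * u\<bar> \<le> \<bar>v\<bar> * \<bar>u\<bar>" by (rule abs_le_mult)
  also have "\<dots> \<le> (c *\<^sub>R 1) * \<bar>u\<bar>" using assms by (rule mult_right_mono) simp
  finally show "\<bar>v * u\<bar> \<le> c *\<^sub>R \<bar>u\<bar>" by simp
qed

section \<open>A conditional expectation inside the universal completion\<close>

text \<open>Computations take place in the universal completion, where products are available; \<open>L\<close> is
  the copy of \<open>E\<close> there and \<open>\<tau>\<close> is \<open>T\<close> transported to it. Outside \<open>L\<close> the value of \<open>\<tau>\<close> is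
  arbitrary, which is why membership in \<open>L\<close> has to be tracked for every product.\<close>

locale riesz_expectation =
  fixes j :: "'a::dedekind_complete_riesz_space \<Rightarrow> 'u::universally_complete_f_algebra"
    and T :: "'a \<Rightarrow> 'a" and e :: 'a
  assumes expectation: "conditional_expectation T" and T_unit: "T e = e"
    and completion: "universal_completion j" and j_unit: "j e = 1"
begin

lemma linear_j: "linear j" and inj_j: "inj j"
  and j_sup: "j (sup x y) = sup (j x) (j y)"
  and j_inf: "j (inf x y) = inf (j x) (j y)"
  and order_dense: "0 < u \<Longrightarrow> \<exists>x. 0 < j x \<and> j x \<le> u"
  using completion unfolding universal_completion_def by auto

lemmas j_simps = linear_add[OF linear_j] linear_diff[OF linear_j] linear_neg[OF linear_j]
  linear_scale[OF linear_j] linear_0[OF linear_j] j_sup j_inf j_unit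

lemma j_le_iff: "j x \<le> j y \<longleftrightarrow> x \<le> y"
  by (metis inj_j injD inf.order_iff j_inf)

lemma j_abs: "j \<bar>x\<bar> = \<bar>j x\<bar>"
  by (simp add: abs_lattice j_simps)

lemma inv_j: "inv j (j x) = x"
  using inj_j by (rule inv_f_f)

lemma unit_nonneg: "0 \<le> e"
  using j_le_iff[of 0 e] by (simp add: j_simps one_nonneg)

lemma linear_T: "linear T" and T_nonneg: "0 \<le> x \<Longrightarrow> 0 \<le> T x"
  and T_continuous: "order_limit F x \<Longrightarrow> order_limit (filtermap T F) (T x)"
  and T_idem: "T (T x) = T x" and riesz_range_T: "riesz_subspace (range T)"
  using expectation unfolding conditional_expectation_def order_continuous_def by auto

lemma unit_in_range: "e \<in> range T"
  using T_unit by (metis rangeI)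

text \<open>If a net in the range of the projection \<open>T\<close> tends to \<open>x\<close>, then the same net, being its own image,
  tends to \<open>T x\<close>.\<close>

lemma order_closed_range_T: "order_closed (range T)"
  unfolding order_closed_def
proof (intro allI impI)
  fix F x assume F: "F \<noteq> bot" "\<forall>\<^sub>F y in F. y \<in> range T" "order_limit F x"
  have fix_ev: "\<forall>\<^sub>F y in F. T y = y"
    using F(2) by (rule eventually_mono) (auto simp: T_idem)
  have "filtermap T F = F"
    unfolding filter_eq_iff eventually_filtermap
  proof
    fix P :: "'a \<Rightarrow> bool"
    have "\<forall>\<^sub>F y in F. P (T y) = P y" using fix_ev by (rule eventually_mono) simp
    then show "eventually (\<lambda>y. P (T y)) F = eventually P F" by (rule eventually_subst)
  qed
  then have "T x = x"
    using order_limit_unique[OF _ F(3) F(1)] T_continuous[OF F(3)] by metis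
  then show "x \<in> range T" by (metis rangeI)
qed

definition L where "L = range j"

lemma j_in_L: "j x \<in> L" by (simp add: L_def)

lemma L_subspace: "subspace L"
  unfolding L_def using linear_j by (intro linear_subspace_image subspace_UNIV)

lemma L_closed:
  "u \<in> L \<Longrightarrow> v \<in> L \<Longrightarrow> u + v \<in> L" "u \<in> L \<Longrightarrow> v \<in> L \<Longrightarrow> u - v \<in> L"
  "u \<in> L \<Longrightarrow> c *\<^sub>R u \<in> L" "u \<in> L \<Longrightarrow> - u \<in> L" "0 \<in> L" "1 \<in> L"
  "u \<in> L \<Longrightarrow> v \<in> L \<Longrightarrow> sup u v \<in> L" "u \<in> L \<Longrightarrow> v \<in> L \<Longrightarrow> inf u v \<in> L" "u \<in> L \<Longrightarrow> \<bar>u\<bar> \<in> L"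
  using L_subspace j_unit
  by (auto intro: subspace_add subspace_diff subspace_scale subspace_neg subspace_0)
    (auto simp: L_def simp flip: j_simps(6-8) j_abs)

text \<open>Below \<open>u\<close> the elements of \<open>E\<close> have a supremum \<open>s\<close> in \<open>E\<close>. If \<open>j s\<close> exceeded \<open>u\<close> somewhere, or fell short
  of it, order density would provide a positive element of \<open>E\<close> by which \<open>s\<close> could be lowered,
  respectively raised.\<close>

lemma L_ideal_pos:
  assumes "0 \<le> u" "u \<le> j x"
  shows "u \<in> L"
proof -
  define D where "D = {y. 0 \<le> y \<and> j y \<le> u}"
  have D0: "0 \<in> D" using assms(1) by (simp add: D_def j_simps)
  have "y \<le> x" if "y \<in> D" for y
    using that assms(2) by (auto simp: D_def simp flip: j_le_iff intro: order_trans)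
  then have bdd: "bdd_above D" by (intro bdd_aboveI[of _ x]) auto
  let ?s = "Sup D"
  have s0: "0 \<le> ?s" using D0 bdd by (rule cSup_upper)
  have "\<not> 0 < sup (j ?s - u) 0"
  proof
    assume "0 < sup (j ?s - u) 0"
    then obtain v where v: "0 < j v" "j v \<le> sup (j ?s - u) 0" using order_dense by blast
    have "y \<le> ?s - v" if "y \<in> D" for y
    proof -
      have "j y \<le> inf (j ?s) u"
        using that cSup_upper[OF that bdd] by (auto simp: D_def j_le_iff)
      also have "\<dots> = j ?s - sup (j ?s - u) 0"
        unfolding diff_inf_eq_pprt[symmetric] by simp
      also have "\<dots> \<le> j ?s - j v" using v(2) by (rule diff_left_mono)
      finally show ?thesis by (simp only: j_le_iff flip: j_simps(2))
    qed
    then have "?s \<le> ?s - v" using D0 by (intro cSup_least) auto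
    then have "v \<le> 0" by simp
    then show False using v(1) by (metis j_le_iff j_simps(5) leD)
  qed
  then have "sup (j ?s - u) 0 = 0" using sup_ge2[of 0 "j ?s - u"] by (simp add: less_le)
  then have su: "j ?s \<le> u" by (metis diff_le_0_iff_le sup_ge1)
  have "j ?s = u"
  proof (rule ccontr)
    assume "j ?s \<noteq> u"
    with su have "0 < u - j ?s" by (simp add: less_le)
    then obtain v where v: "0 < j v" "j v \<le> u - j ?s" using order_dense by blast
    have "0 \<le> v" using v(1) by (metis j_le_iff j_simps(5) less_imp_le)
    then have "?s + v \<in> D"
      using v(2) s0 by (simp add: D_def j_simps le_diff_eq add.commute)
    then have "?s + v \<le> ?s" using bdd by (rule cSup_upper)
    then have "v \<le> 0" by simp
    then show False using v(1) by (metis j_le_iff j_simps(5) leD)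
  qed
  then show ?thesis using j_in_L by metis
qed

lemma L_ideal:
  assumes "\<bar>u\<bar> \<le> v" "v \<in> L"
  shows "u \<in> L"
proof -
  obtain x where x: "v = j x" using assms(2) by (auto simp: L_def)
  note d = pprt_nprt_decomp[of u]
  have "sup u 0 \<le> \<bar>u\<bar>" "sup (- u) 0 \<le> \<bar>u\<bar>"
    by (simp_all add: abs_ge_self abs_ge_minus_self)
  then have "sup u 0 \<in> L" "sup (- u) 0 \<in> L"
    using assms(1) x by (auto intro!: L_ideal_pos[of _ x] simp del: sup.bounded_iff intro: order_trans)
  then show ?thesis by (subst d(1)) (rule L_closed(2))
qed

lemma bounded_in_L: "\<bar>u\<bar> \<le> c *\<^sub>R 1 \<Longrightarrow> u \<in> L"
  by (rule L_ideal) (auto intro: L_closed)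

lemma mult_bounded_in_L:
  assumes "\<bar>v\<bar> \<le> c *\<^sub>R 1" "u \<in> L"
  shows "u * v \<in> L" "v * u \<in> L"
  using abs_mult_bounded[OF assms(1), of u] assms(2) by (auto intro: L_ideal L_closed)

definition \<tau> where "\<tau> u = j (T (inv j u))"

lemma \<tau>_j: "\<tau> (j x) = j (T x)" by (simp add: \<tau>_def inv_j)

lemma \<tau>_in_L: "\<tau> u \<in> L" by (simp add: \<tau>_def j_in_L)

lemma \<tau>_add: "u \<in> L \<Longrightarrow> v \<in> L \<Longrightarrow> \<tau> (u + v) = \<tau> u + \<tau> v"
  and \<tau>_diff: "u \<in> L \<Longrightarrow> v \<in> L \<Longrightarrow> \<tau> (u - v) = \<tau> u - \<tau> v"
  and \<tau>_scale: "u \<in> L \<Longrightarrow> \<tau> (c *\<^sub>R u) = c *\<^sub>R \<tau> u"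
  by (auto simp: L_def \<tau>_j linear_add[OF linear_T] linear_diff[OF linear_T]
      linear_scale[OF linear_T] j_simps(1,2,4) simp flip: j_simps(1,2,4))

lemma \<tau>_idem: "u \<in> L \<Longrightarrow> \<tau> (\<tau> u) = \<tau> u"
  by (auto simp: L_def \<tau>_j T_idem)

lemma \<tau>_zero: "\<tau> 0 = 0"
  using \<tau>_scale[of 0 0] L_closed(5) by simp

lemma \<tau>_one: "\<tau> 1 = 1"
  using \<tau>_j[of e] T_unit j_unit by simp

lemma \<tau>_nonneg: "u \<in> L \<Longrightarrow> 0 \<le> u \<Longrightarrow> 0 \<le> \<tau> u"
  using j_le_iff[of 0] T_nonneg by (auto simp: L_def \<tau>_j j_simps)

lemma \<tau>_mono: "u \<in> L \<Longrightarrow> v \<in> L \<Longrightarrow> u \<le> v \<Longrightarrow> \<tau> u \<le> \<tau> v"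
  using \<tau>_nonneg[of "v - u"] by (simp add: \<tau>_diff L_closed)

lemma \<tau>_abs: "u \<in> L \<Longrightarrow> \<bar>\<tau> u\<bar> \<le> \<tau> \<bar>u\<bar>"
  using \<tau>_mono[of u "\<bar>u\<bar>"] \<tau>_mono[of "- u" "\<bar>u\<bar>"] \<tau>_scale[of u "- 1"]
  by (intro abs_leI) (auto simp: L_closed abs_ge_self abs_ge_minus_self)

text \<open>The hypothesis \<open>n g\<^sub>n \<le> w\<close> guarantees that the infimum of the \<open>g\<^sub>n\<close> in \<open>E\<close> is zero. The bound \<open>w\<close> may
  lie outside \<open>L\<close>, as it does when it arises from \<open>truncation_error\<close>.\<close>

lemma \<tau>_vanishing:
  assumes g: "\<And>n. g n \<in> L" "\<And>n. 0 \<le> g n" "decseq g" "\<And>n. real n *\<^sub>R g n \<le> w"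
    and z: "\<And>n. \<bar>z\<bar> \<le> \<tau> (g n)"
  shows "z = 0"
proof -
  define h where "h n = inv j (g n)" for n
  have jh: "j (h n) = g n" for n
    using g(1)[of n] unfolding h_def L_def by (rule f_inv_into_f)
  have h0: "0 \<le> h n" for n using g(2)[of n] j_le_iff[of 0 "h n"] by (simp add: jh j_simps)
  have "order_limit (filtermap h sequentially) 0"
  proof (rule order_limit_sequenceI[where d = h])
    have "h n \<le> h m" if "m \<le> n" for m n
      using decseqD[OF g(3) that] by (simp add: jh flip: j_le_iff)
    then show "decseq h" by (simp add: decseq_def)
    fix x assume x: "\<And>n. x \<le> h n"
    have "real n *\<^sub>R j x \<le> w" for n
    proof -
      have "real n *\<^sub>R j x \<le> real n *\<^sub>R g n"
        using x[of n] by (intro scaleR_left_mono) (simp_all add: j_le_iff flip: jh)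
      then show ?thesis using g(4)[of n] by (rule order_trans)
    qed
    then have "j x \<le> 0" by (rule archimedean)
    then show "x \<le> 0" using j_le_iff[of x 0] by (simp add: j_simps)
  qed (use h0 in auto)
  then have lim: "order_limit (filtermap T (filtermap h sequentially)) 0"
    using T_continuous[of _ 0] by (simp only: linear_0[OF linear_T])
  obtain x where x: "z = j x"
    using L_ideal[OF z \<tau>_in_L] by (auto simp: L_def)
  have "\<bar>x\<bar> \<le> \<bar>T (h n)\<bar>" for n
  proof -
    have "j \<bar>x\<bar> \<le> j (T (h n))" using z[of n] by (simp add: x j_abs \<tau>_def h_def)
    then show ?thesis using abs_ge_self[of "T (h n)"] by (metis j_le_iff order_trans)
  qed
  then have "x = 0"
    by (intro order_limit_zero_dominates[OF lim]) (auto simp: filtermap_bot_iff eventually_filtermap)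
  then show ?thesis by (simp add: x j_simps)
qed

text \<open>An element dominated by the expected truncation errors of \<open>u\<close>, weighted by \<open>w\<close>, is zero: apply
  \<open>\<tau>_vanishing\<close> with the bound \<open>c w u\<^sup>2\<close>.\<close>

lemma truncation_vanishes:
  assumes u: "0 \<le> u" and w: "0 \<le> w" "w * u \<in> L" and c: "0 \<le> c"
    and z: "\<And>n. \<bar>z\<bar> \<le> c *\<^sub>R \<tau> (w * sup (u - real n *\<^sub>R 1) 0)"
  shows "z = 0"
proof -
  let ?g = "\<lambda>n::nat. sup (u - real n *\<^sub>R 1) 0"
  have inL: "w * ?g n \<in> L" for n
    using truncation_error(2)[OF u, of n] w
    by (intro L_ideal[OF _ w(2)]) (simp add: mult_left_mono)
  show ?thesis
  proof (rule \<tau>_vanishing[where g = "\<lambda>n. c *\<^sub>R (w * ?g n)"])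
    show "decseq (\<lambda>n. c *\<^sub>R (w * ?g n))"
      using c w(1)
      by (auto simp: decseq_def one_nonneg intro!: scaleR_left_mono mult_left_mono sup_mono diff_left_mono scaleR_right_mono)
    show "real n *\<^sub>R c *\<^sub>R (w * ?g n) \<le> c *\<^sub>R (w * (u * u))" for n
    proof -
      have "c *\<^sub>R (w * (real n *\<^sub>R ?g n)) \<le> c *\<^sub>R (w * (u * u))"
        using c w(1) truncation_error(1)[OF u, of n] by (intro scaleR_left_mono mult_left_mono)
      then show ?thesis by (simp add: mult.commute)
    qed
  qed (use c w(1) z inL in \<open>auto simp: L_closed \<tau>_scale scaleR_nonneg_nonneg\<close>)
qed

section \<open>Extension from components to the whole subspace\<close>

lemma j_component: "p \<in> components e \<Longrightarrow> j p \<in> components 1"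
  by (simp add: components_def flip: j_simps)

lemma component_bounded:
  assumes "p \<in> components 1"
  shows "\<bar>p\<bar> \<le> 1 *\<^sub>R (1::'u)"
  using components_bounds[OF assms] by simp

text \<open>Multiplication by a component is the band projection onto the disjoint complement of \<open>e - p\<close>; it links
  conditional independence, stated for band projections, to products.\<close>

lemma component_projection:
  assumes p: "p \<in> components e"
  defines "P \<equiv> \<lambda>x. inv j (j p * j x)"
  shows "band_projection P" "P e = p" "j (P x) = j p * j x"
proof -
  note jp = j_component[OF p]
  have disj: "inf (j p) (1 - j p) = 0" using jp by (simp add: components_def)
  show jP: "j (P x) = j p * j x" for x
    using mult_bounded_in_L(2)[OF component_bounded[OF jp] j_in_L]
    unfolding P_def L_def by (rule f_inv_into_f)
  show "P e = p" by (simp add: P_def j_unit inv_j)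
  have pos: "0 \<le> j p" "0 \<le> 1 - j p" using components_bounds[OF jp] by simp_all
  show "band_projection P"
    unfolding band_projection_def
  proof (intro exI[of _ "disjoint_complement {e - p}"] conjI allI band_disjoint_complement)
    fix x
    have "inf (\<bar>j p * j x\<bar>) (1 - j p) \<le> inf (j p * \<bar>j x\<bar>) (1 - j p)"
      using abs_le_mult[of "j p" "j x"] pos by (intro inf_mono) simp_all
    also have "\<dots> = 0" using disj by (intro f_algebra_right) simp_all
    finally have "inf (\<bar>j p * j x\<bar>) (1 - j p) = 0" using pos by (intro antisym) simp_all
    then have "j (inf (\<bar>P x\<bar>) (\<bar>e - p\<bar>)) = j 0"
      using pos by (simp add: j_simps j_abs jP)
    then show "P x \<in> disjoint_complement {e - p}"
      using inj_j by (simp add: disjoint_complement_def inj_eq)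
    show "x - P x \<in> disjoint_complement (disjoint_complement {e - p})"
      unfolding disjoint_complement_def[of "disjoint_complement {e - p}"]
    proof safe
      fix y assume "y \<in> disjoint_complement {e - p}"
      then have "j (inf (\<bar>y\<bar>) (\<bar>e - p\<bar>)) = j 0" by (simp add: disjoint_complement_def)
      then have y: "inf (1 - j p) (\<bar>j y\<bar>) = 0"
        using pos by (simp add: j_simps j_abs inf_commute)
      have eq: "j (x - P x) = (1 - j p) * j x"
        by (simp add: j_simps jP left_diff_distrib)
      have "inf (\<bar>j (x - P x)\<bar>) (\<bar>j y\<bar>) \<le> inf ((1 - j p) * \<bar>j x\<bar>) (\<bar>j y\<bar>)"
        unfolding eq using abs_le_mult[of "1 - j p" "j x"] pos by (intro inf_mono) simp_all
      also have "\<dots> = 0" using y by (intro f_algebra_right) simp_all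
      finally have "j (inf (\<bar>x - P x\<bar>) (\<bar>y\<bar>)) = j 0"
        by (intro antisym) (simp_all add: j_simps j_abs)
      then show "inf (\<bar>x - P x\<bar>) (\<bar>y\<bar>) = 0"
        using inj_j by (simp add: inj_eq)
    qed
  qed
qed

definition unit_bounded where "unit_bounded u \<longleftrightarrow> (\<exists>c. \<bar>u\<bar> \<le> c *\<^sub>R (1::'u))"

lemma unit_bounded_zero: "unit_bounded 0"
  unfolding unit_bounded_def by (rule exI[of _ 0]) simp

lemma unit_bounded_add: "unit_bounded u \<Longrightarrow> unit_bounded v \<Longrightarrow> unit_bounded (u + v)"
  unfolding unit_bounded_def
proof safe
  fix c d assume "\<bar>u\<bar> \<le> c *\<^sub>R 1" "\<bar>v\<bar> \<le> d *\<^sub>R 1"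
  then have "\<bar>u\<bar> + \<bar>v\<bar> \<le> (c + d) *\<^sub>R 1" unfolding scaleR_add_left by (rule add_mono)
  with abs_triangle_ineq have "\<bar>u + v\<bar> \<le> (c + d) *\<^sub>R 1" by (rule order_trans)
  then show "\<exists>c. \<bar>u + v\<bar> \<le> c *\<^sub>R 1" ..
qed

lemma unit_bounded_scale: "unit_bounded u \<Longrightarrow> unit_bounded (c *\<^sub>R u)"
  unfolding unit_bounded_def
proof safe
  fix d assume "\<bar>u\<bar> \<le> d *\<^sub>R 1"
  then have "\<bar>c *\<^sub>R u\<bar> \<le> \<bar>c\<bar> *\<^sub>R (d *\<^sub>R 1)"
    unfolding abs_scaleR_riesz by (intro scaleR_left_mono) simp_all
  then show "\<exists>d. \<bar>c *\<^sub>R u\<bar> \<le> d *\<^sub>R 1" by auto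
qed

lemma unit_bounded_in_L: "unit_bounded u \<Longrightarrow> u \<in> L"
  unfolding unit_bounded_def using bounded_in_L by blast

lemma unit_bounded_mult_in_L: "unit_bounded v \<Longrightarrow> u \<in> L \<Longrightarrow> u * v \<in> L" "unit_bounded v \<Longrightarrow> u \<in> L \<Longrightarrow> v * u \<in> L"
  unfolding unit_bounded_def using mult_bounded_in_L by blast+

lemma unit_bounded_component: "p \<in> components 1 \<Longrightarrow> unit_bounded p"
  unfolding unit_bounded_def using component_bounded by blast

text \<open>The first stage of every extension from components. Linearity and continuity of \<open>G\<close> are
  asked for only on bounded arguments, since the maps \<open>v \<mapsto> \<tau> (u v)\<close> to which this is applied are
  meaningful only for those \<open>v\<close> with \<open>u v\<close> in \<open>L\<close>.\<close>

lemma vanish_on_bounded: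
  assumes S: "riesz_subspace S" "order_closed S" "e \<in> S"
    and add: "\<And>u v. unit_bounded u \<Longrightarrow> unit_bounded v \<Longrightarrow> G (u + v) = G u + G v"
    and scale: "\<And>c u. unit_bounded u \<Longrightarrow> G (c *\<^sub>R u) = c *\<^sub>R G u"
    and bound: "\<And>u \<epsilon>. 0 < \<epsilon> \<Longrightarrow> \<bar>u\<bar> \<le> \<epsilon> *\<^sub>R 1 \<Longrightarrow> \<bar>G u\<bar> \<le> \<epsilon> *\<^sub>R (w::'u)"
    and comp: "\<And>p. p \<in> S \<Longrightarrow> p \<in> components e \<Longrightarrow> G (j p) = (0::'u)"
    and y: "y \<in> S" "unit_bounded (j y)"
  shows "G (j y) = 0"
proof -
  have zero: "G 0 = 0" using scale[OF unit_bounded_zero, of 0] by simp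
  define V where "V = {x. unit_bounded (j x) \<and> G (j x) = 0}"
  have "subspace V"
    by (rule subspaceI)
      (auto simp: V_def j_simps unit_bounded_add unit_bounded_scale unit_bounded_zero add scale zero)
  moreover have "S \<inter> components e \<subseteq> V"
    using comp unit_bounded_component[OF j_component] by (auto simp: V_def)
  ultimately have V: "span (S \<inter> components e) \<subseteq> V" by (rule span_minimal[rotated])
  obtain c where "\<bar>j y\<bar> \<le> c *\<^sub>R 1" using y(2) by (auto simp: unit_bounded_def)
  then have c: "\<bar>y\<bar> \<le> c *\<^sub>R e" by (simp add: j_simps j_abs flip: j_le_iff)
  have "\<bar>G (j y)\<bar> \<le> \<epsilon> *\<^sub>R w" if \<epsilon>: "0 < \<epsilon>" for \<epsilon>
  proof -
    obtain s where s: "s \<in> V" "\<bar>y - s\<bar> \<le> \<epsilon> *\<^sub>R e"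
      using step_approximation[OF S y(1) unit_nonneg c \<epsilon>] V by blast
    have ys: "\<bar>j y - j s\<bar> \<le> \<epsilon> *\<^sub>R 1"
      using s(2) by (simp add: j_simps j_abs flip: j_le_iff)
    then have "unit_bounded (j y - j s)" by (auto simp: unit_bounded_def)
    then have "G (j y) = G (j y - j s)"
      using add[of "j y - j s" "j s"] s(1) by (simp add: V_def)
    then show ?thesis using bound[OF \<epsilon> ys] by simp
  qed
  then show ?thesis by (rule archimedean_abs)
qed

text \<open>Commutativity is not among the axioms of the multiplication. Components commute with everything,
  by \<open>components_one_commute\<close>, and hence so do the uniform limits of their combinations.\<close>

lemma bounded_commute:
  assumes "unit_bounded v"
  shows "v * u = u * v"
proof -
  obtain y where y: "v = j y" using unit_bounded_in_L[OF assms] by (auto simp: L_def)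
  have "j y * u - u * j y = 0"
  proof (rule vanish_on_bounded[where S = UNIV and w = "2 *\<^sub>R \<bar>u\<bar>" and G = "\<lambda>v. v * u - u * v"])
    show "order_closed (UNIV :: 'a set)" "riesz_subspace (UNIV :: 'a set)"
      by (simp_all add: order_closed_def riesz_subspace_def)
    fix v \<epsilon> assume v: "\<bar>v\<bar> \<le> \<epsilon> *\<^sub>R (1::'u)"
    have "\<bar>v * u - u * v\<bar> \<le> \<bar>v * u\<bar> + \<bar>u * v\<bar>"
      by (rule abs_triangle_ineq4)
    also have "\<dots> \<le> \<epsilon> *\<^sub>R \<bar>u\<bar> + \<epsilon> *\<^sub>R \<bar>u\<bar>"
      using abs_mult_bounded[OF v] by (rule add_mono[rotated])
    finally show "\<bar>v * u - u * v\<bar> \<le> \<epsilon> *\<^sub>R (2 *\<^sub>R \<bar>u\<bar>)"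
      by (simp add: scaleR_2 scaleR_add_right)
  next
    show "j p * u - u * j p = 0" if "p \<in> components e" for p
      using components_one_commute[OF j_component[OF that]] by simp
  qed (use assms y in \<open>auto simp: algebra_simps\<close>)
  then show ?thesis by (simp add: y)
qed

section \<open>Averaging\<close>

text \<open>If \<open>u \<le> n\<close> then \<open>p u \<le> n p\<close>, so that \<open>\<tau> (p u) \<le> n p\<close> is annihilated by \<open>1 - p\<close>; the general case
  follows by truncation.\<close>

lemma expectation_off_component:
  assumes p: "p \<in> components 1" "\<tau> p = p" and u: "u \<in> L" "0 \<le> u"
  shows "(1 - p) * \<tau> (p * u) = 0"
proof -
  have pb: "unit_bounded p" using p(1) by (rule unit_bounded_component)
  have p01: "0 \<le> p" "p \<le> 1" using components_bounds[OF p(1)] by auto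
  show ?thesis
  proof (rule truncation_vanishes[of u 1 1])
    fix n :: nat
    let ?r = "inf u (real n *\<^sub>R 1)" let ?g = "sup (u - real n *\<^sub>R 1) 0"
    have ur: "u = ?r + ?g" by (metis add.commute diff_add_cancel diff_inf_eq_pprt)
    have r: "0 \<le> ?r" using u(2) by (simp add: one_nonneg scaleR_nonneg_nonneg)
    have L: "?r \<in> L" "?g \<in> L" using u(1) by (auto intro!: L_closed)
    note pL = unit_bounded_mult_in_L(2)[OF pb]
    have pu: "p * u \<in> L" "0 \<le> p * u" using pL u p01 by auto
    have "p * ?r \<le> p * (real n *\<^sub>R 1)" using p01 by (intro mult_left_mono) auto
    then have "\<tau> (p * ?r) \<le> \<tau> (real n *\<^sub>R p)"
      using pL L unit_bounded_in_L[OF pb] by (intro \<tau>_mono) (auto intro: L_closed)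
    then have 1: "\<tau> (p * ?r) \<le> real n *\<^sub>R p"
      using unit_bounded_in_L[OF pb] p(2) by (simp add: \<tau>_scale)
    have "p * ?g \<le> 1 * ?g" using p01 by (intro mult_right_mono) auto
    then have 2: "\<tau> (p * ?g) \<le> \<tau> ?g" using pL L by (intro \<tau>_mono) auto
    have "p * u = p * ?r + p * ?g" by (subst ur) (rule distrib_left)
    then have "\<tau> (p * u) = \<tau> (p * ?r) + \<tau> (p * ?g)"
      using pL L by (simp add: \<tau>_add)
    also have "\<dots> \<le> real n *\<^sub>R p + \<tau> ?g" using 1 2 by (rule add_mono)
    finally have "(1 - p) * \<tau> (p * u) \<le> (1 - p) * (real n *\<^sub>R p + \<tau> ?g)"
      using p01 by (intro mult_left_mono) auto
    also have "\<dots> = (1 - p) * \<tau> ?g"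
      using components_one_idem(2)[OF p(1)] by (simp add: distrib_left)
    also have "\<dots> \<le> 1 * \<tau> ?g"
      using p01 L by (intro mult_right_mono \<tau>_nonneg) auto
    finally have "(1 - p) * \<tau> (p * u) \<le> \<tau> ?g" by simp
    moreover have "0 \<le> (1 - p) * \<tau> (p * u)"
      using mult_nonneg_nonneg[OF _ \<tau>_nonneg[OF pu], of "1 - p"] p01 by simp
    ultimately show "\<bar>(1 - p) * \<tau> (p * u)\<bar> \<le> 1 *\<^sub>R \<tau> (1 * ?g)" by simp
  qed (use u in \<open>auto simp: one_nonneg\<close>)
qed

text \<open>Apply the preceding lemma to \<open>p\<close> and to \<open>1 - p\<close>: neither \<open>\<tau> (p u)\<close> nor \<open>\<tau> ((1 - p) u)\<close>
  leaves its component.\<close>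

lemma averaging_component:
  assumes p: "p \<in> components 1" "\<tau> p = p" and u: "u \<in> L"
  shows "\<tau> (p * u) = p * \<tau> u"
proof -
  have pb: "unit_bounded p" using p(1) by (rule unit_bounded_component)
  note pL = unit_bounded_mult_in_L(2)[OF pb]
  have *: "\<tau> (p * v) = p * \<tau> v" if v: "v \<in> L" "0 \<le> v" for v
  proof -
    let ?q = "1 - p"
    have q: "?q \<in> components 1" "\<tau> ?q = ?q"
      using p unit_bounded_in_L[OF pb] by (simp_all add: components_def inf_commute \<tau>_diff \<tau>_one L_closed)
    have "(1 - p) * \<tau> (p * v) = 0" using expectation_off_component[OF p v] .
    moreover have "p * \<tau> (v - p * v) = 0"
      using expectation_off_component[OF q v] by (simp add: left_diff_distrib)
    then have "p * (\<tau> v - \<tau> (p * v)) = 0"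
      using v pL by (simp add: \<tau>_diff)
    ultimately show ?thesis by (simp add: left_diff_distrib right_diff_distrib)
  qed
  obtain P N where PN: "u = P - N" "0 \<le> P" "0 \<le> N" "P = sup u 0" "N = sup (- u) 0"
    using pprt_nprt_decomp[of u] by blast
  then have "P \<in> L" "N \<in> L" using u by (auto intro: L_closed)
  then show ?thesis
    using *[of P] *[of N] pL PN(2,3) by (simp add: PN(1) \<tau>_diff right_diff_distrib)
qed

lemma averaging:
  assumes r: "r \<in> range T" "unit_bounded (j r)" and u: "u \<in> L"
  shows "\<tau> (j r * u) = j r * \<tau> u"
proof -
  have "\<tau> (j r * u) - j r * \<tau> u = 0"
  proof (rule vanish_on_bounded[where S = "range T" and w = "2 *\<^sub>R \<tau> \<bar>u\<bar>" and G = "\<lambda>v. \<tau> (v * u) - v * \<tau> u"])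
    fix v \<epsilon> assume \<epsilon>: "0 < \<epsilon>" and v: "\<bar>v\<bar> \<le> \<epsilon> *\<^sub>R (1::'u)"
    then have vu: "v * u \<in> L" by (intro unit_bounded_mult_in_L u) (auto simp: unit_bounded_def)
    have "\<bar>\<tau> (v * u)\<bar> \<le> \<tau> \<bar>v * u\<bar>" using vu by (rule \<tau>_abs)
    also have "\<dots> \<le> \<tau> (\<epsilon> *\<^sub>R \<bar>u\<bar>)"
      using vu u abs_mult_bounded(2)[OF v] by (intro \<tau>_mono L_closed)
    finally have 1: "\<bar>\<tau> (v * u)\<bar> \<le> \<epsilon> *\<^sub>R \<tau> \<bar>u\<bar>" using u by (simp add: \<tau>_scale L_closed)
    have "\<bar>v * \<tau> u\<bar> \<le> \<epsilon> *\<^sub>R \<bar>\<tau> u\<bar>" by (rule abs_mult_bounded(2)[OF v])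
    also have "\<dots> \<le> \<epsilon> *\<^sub>R \<tau> \<bar>u\<bar>" using \<epsilon> u by (intro scaleR_left_mono \<tau>_abs) simp_all
    finally have 2: "\<bar>v * \<tau> u\<bar> \<le> \<epsilon> *\<^sub>R \<tau> \<bar>u\<bar>" .
    have "\<bar>\<tau> (v * u) - v * \<tau> u\<bar> \<le> \<bar>\<tau> (v * u)\<bar> + \<bar>v * \<tau> u\<bar>" by (rule abs_triangle_ineq4)
    also have "\<dots> \<le> \<epsilon> *\<^sub>R \<tau> \<bar>u\<bar> + \<epsilon> *\<^sub>R \<tau> \<bar>u\<bar>" using 1 2 by (rule add_mono)
    finally show "\<bar>\<tau> (v * u) - v * \<tau> u\<bar> \<le> \<epsilon> *\<^sub>R (2 *\<^sub>R \<tau> \<bar>u\<bar>)"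
      by (simp add: scaleR_2 scaleR_add_right)
  next
    fix p assume "p \<in> range T" "p \<in> components e"
    then show "\<tau> (j p * u) - j p * \<tau> u = 0"
      using averaging_component[OF j_component _ u] by (auto simp: \<tau>_j T_idem)
  next
    fix v v' assume "unit_bounded v" "unit_bounded v'"
    then show "\<tau> ((v + v') * u) - (v + v') * \<tau> u = \<tau> (v * u) - v * \<tau> u + (\<tau> (v' * u) - v' * \<tau> u)"
      using u by (simp add: distrib_right \<tau>_add unit_bounded_mult_in_L)
  next
    fix c v assume "unit_bounded v"
    then show "\<tau> (c *\<^sub>R v * u) - c *\<^sub>R v * \<tau> u = c *\<^sub>R (\<tau> (v * u) - v * \<tau> u)"
      using u by (simp add: \<tau>_scale unit_bounded_mult_in_L scaleR_diff_right)
  qed (use r riesz_range_T order_closed_range_T unit_in_range in auto)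
  then show ?thesis by simp
qed

section \<open>Square integrable elements\<close>

lemma square_L_mult:
  assumes "u * u \<in> L" "v * v \<in> L"
  shows "\<bar>u\<bar> * \<bar>v\<bar> \<in> L" "u * v \<in> L"
proof -
  have "\<bar>u\<bar> * \<bar>v\<bar> \<le> \<bar>u\<bar> * \<bar>u\<bar> + \<bar>v\<bar> * \<bar>v\<bar>" by (rule mult_le_squares) simp_all
  then have 1: "\<bar>u\<bar> * \<bar>v\<bar> \<le> u * u + v * v" by (simp only: square_eq_pprt(2))
  moreover have "0 \<le> \<bar>u\<bar> * \<bar>v\<bar>" by simp
  ultimately have "\<bar>\<bar>u\<bar> * \<bar>v\<bar>\<bar> \<le> u * u + v * v" by (simp only: abs_of_nonneg)
  then show "\<bar>u\<bar> * \<bar>v\<bar> \<in> L" using assms by (rule L_ideal[OF _ L_closed(1)])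
  have "\<bar>u * v\<bar> \<le> u * u + v * v" using abs_le_mult 1 by (rule order_trans)
  then show "u * v \<in> L" using assms by (rule L_ideal[OF _ L_closed(1)])
qed

lemma square_L_diff:
  assumes "u * u \<in> L" "v * v \<in> L"
  shows "(u - v) * (u - v) \<in> L"
  using assms square_L_mult(2)[OF assms] square_L_mult(2)[OF assms(2,1)]
  by (simp add: left_diff_distrib right_diff_distrib L_closed)

text \<open>A form of Jensen's inequality. Let \<open>t = \<tau> \<bar>j x\<bar>\<close> and \<open>r = inf t n\<close>. Taking the expectation of
  \<open>2 r \<bar>j x\<bar> \<le> r\<^sup>2 + \<bar>j x\<bar>\<^sup>2\<close> and averaging gives \<open>2 r t \<le> r\<^sup>2 + \<tau> (\<bar>j x\<bar>\<^sup>2)\<close>, and \<open>r \<le> t\<close> turns this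
  into \<open>r t \<le> \<tau> (\<bar>j x\<bar>\<^sup>2)\<close>. As \<open>n\<close> grows the left side approaches \<open>t\<^sup>2\<close>, with error controlled by
  \<open>t\<^sup>3 / n\<close>.\<close>

lemma square_L_expectation:
  assumes x: "j x * j x \<in> L"
  shows "j (T x) * j (T x) \<in> L"
proof -
  let ?u = "\<bar>j x\<bar>"
  let ?t = "\<tau> ?u"
  have u: "?u \<in> L" "0 \<le> ?u" by (simp_all add: j_in_L L_closed)
  have t: "0 \<le> ?t" using u by (rule \<tau>_nonneg)
  let ?r = "\<lambda>n::nat. inf ?t (real n *\<^sub>R 1)"
  have low: "?r n * ?t \<le> \<tau> (?u * ?u)" for n
  proof -
    have r0: "0 \<le> ?r n" using t by (simp add: one_nonneg scaleR_nonneg_nonneg)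
    then have rb: "unit_bounded (?r n)" unfolding unit_bounded_def by (intro exI[of _ "real n"]) simp
    let ?s = "inf (T \<bar>x\<bar>) (real n *\<^sub>R e)"
    have js: "j ?s = ?r n" by (simp add: j_simps j_abs flip: \<tau>_j)
    have s: "?s \<in> range T"
    proof -
      have "real n *\<^sub>R e \<in> range T"
        using riesz_range_T unit_in_range unfolding riesz_subspace_def by (intro subspace_scale) auto
      with rangeI[of T "\<bar>x\<bar>"] show ?thesis
        using riesz_range_T unfolding riesz_subspace_def by blast
    qed
    have av: "\<tau> (?r n * v) = ?r n * \<tau> v" if "v \<in> L" for v
      using averaging[OF s _ that] rb js by simp
    have rL: "?r n \<in> L" using rb by (rule unit_bounded_in_L)
    have "\<tau> (?r n) = ?r n" using s js by (metis T_idem \<tau>_j rangeE)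
    then have rr: "\<tau> (?r n * ?r n) = ?r n * ?r n" using av[OF rL] by simp
    have L: "?r n * ?u \<in> L" "?r n * ?r n \<in> L" "?u * ?u \<in> L"
      using unit_bounded_mult_in_L(2)[OF rb] u rL x by (simp_all only: square_eq_pprt(2))
    have "?r n * ?u + ?r n * ?u \<le> ?r n * ?r n + ?u * ?u"
      using mult_commutator_le_squares[of "?r n" ?u] bounded_commute[OF rb, of ?u] by simp
    then have "\<tau> (?r n * ?u + ?r n * ?u) \<le> \<tau> (?r n * ?r n + ?u * ?u)"
      using L by (intro \<tau>_mono L_closed)
    then have 1: "?r n * ?t + ?r n * ?t \<le> ?r n * ?r n + \<tau> (?u * ?u)"
      using L by (simp add: \<tau>_add rr av u)
    have "?r n * ?r n \<le> ?r n * ?t" using r0 by (intro mult_left_mono) simp_all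
    then have "?r n * ?t + ?r n * ?t \<le> ?r n * ?t + \<tau> (?u * ?u)"
      using 1 by (meson add_right_mono order_trans)
    then show ?thesis by (simp only: add_le_cancel_left)
  qed
  have "real n *\<^sub>R (?t * ?t - \<tau> (?u * ?u)) \<le> ?t * ?t * ?t" for n :: nat
  proof -
    have "?t * ?t - \<tau> (?u * ?u) \<le> ?t * ?t - ?r n * ?t" using low by (rule diff_left_mono)
    also have "\<dots> = sup (?t - real n *\<^sub>R 1) 0 * ?t"
      unfolding diff_inf_eq_pprt[symmetric] by (rule left_diff_distrib[symmetric])
    finally have "real n *\<^sub>R (?t * ?t - \<tau> (?u * ?u)) \<le> real n *\<^sub>R (sup (?t - real n *\<^sub>R 1) 0 * ?t)"
      by (rule scaleR_left_mono) simp
    also have "\<dots> = (real n *\<^sub>R sup (?t - real n *\<^sub>R 1) 0) * ?t" by simp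
    also have "\<dots> \<le> ?t * ?t * ?t" using truncation_error(1)[OF t] t by (rule mult_right_mono)
    finally show ?thesis .
  qed
  then have "?t * ?t - \<tau> (?u * ?u) \<le> 0" by (rule archimedean)
  then have tt: "?t * ?t \<le> \<tau> (?u * ?u)" by simp
  have "\<bar>j (T x)\<bar> \<le> ?t" using \<tau>_abs[OF j_in_L, of x] by (simp only: \<tau>_j)
  then have "\<bar>j (T x)\<bar> * \<bar>j (T x)\<bar> \<le> ?t * ?t" using t by (intro mult_mono) simp_all
  then have "\<bar>j (T x) * j (T x)\<bar> \<le> \<tau> (?u * ?u)"
    using tt by (metis abs_le_mult order_trans)
  then show ?thesis using \<tau>_in_L by (rule L_ideal)
qed

section \<open>Conditional independence and uncorrelatedness\<close>

text \<open>For components \<open>x\<close> this is one of the two equations that define independence. Both sides are bounded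
  by \<open>\<tau> \<bar>j x\<bar>\<close>, which carries the identity to bounded, then to positive, then to all \<open>x\<close>.\<close>

lemma indep_component:
  assumes ind: "cond_indep_subspaces e T S1 S2"
    and S1: "riesz_subspace S1" "order_closed S1" "e \<in> S1"
    and x: "x \<in> S1" and q: "q \<in> S2" "q \<in> components e"
  shows "\<tau> (j x * j q) = \<tau> (\<tau> (j x) * j q)"
proof -
  have jq: "j q \<in> components 1" using q(2) by (rule j_component)
  have qb: "unit_bounded (j q)" using jq by (rule unit_bounded_component)
  note qL = unit_bounded_mult_in_L(1)[OF qb]
  define G where "G u = \<tau> (u * j q) - \<tau> (\<tau> u * j q)" for u
  have G_add: "G (u + v) = G u + G v" if "u \<in> L" "v \<in> L" for u v
    using that by (simp add: G_def distrib_right \<tau>_add qL \<tau>_in_L)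
  have G_scale: "G (c *\<^sub>R u) = c *\<^sub>R G u" if "u \<in> L" for c u
    using that by (simp add: G_def \<tau>_scale qL \<tau>_in_L scaleR_diff_right)
  have \<tau>q: "\<bar>\<tau> (u * j q)\<bar> \<le> \<tau> \<bar>u\<bar>" if u: "u \<in> L" for u
  proof -
    have "\<bar>\<tau> (u * j q)\<bar> \<le> \<tau> \<bar>u * j q\<bar>" using qL[OF u] by (rule \<tau>_abs)
    also have "\<dots> \<le> \<tau> \<bar>u\<bar>"
      using abs_mult_bounded(1)[OF component_bounded[OF jq], of u] qL[OF u] u
      by (intro \<tau>_mono) (auto intro: L_closed)
    finally show ?thesis .
  qed
  have G_bound: "\<bar>G u\<bar> \<le> 2 *\<^sub>R \<tau> \<bar>u\<bar>" if u: "u \<in> L" for u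
  proof -
    have "\<bar>\<tau> (\<tau> u * j q)\<bar> \<le> \<tau> \<bar>\<tau> u\<bar>" by (rule \<tau>q) (rule \<tau>_in_L)
    also have "\<dots> \<le> \<tau> (\<tau> \<bar>u\<bar>)"
      using \<tau>_abs[OF u] by (intro \<tau>_mono L_closed(9) \<tau>_in_L)
    also have "\<dots> = \<tau> \<bar>u\<bar>" using u by (intro \<tau>_idem L_closed)
    finally have "\<bar>\<tau> (u * j q)\<bar> + \<bar>\<tau> (\<tau> u * j q)\<bar> \<le> \<tau> \<bar>u\<bar> + \<tau> \<bar>u\<bar>"
      using \<tau>q[OF u] by (intro add_mono)
    then show ?thesis
      unfolding G_def scaleR_2 using abs_triangle_ineq4 by (rule order_trans[rotated])
  qed
  have G_comp: "G (j p) = 0" if p: "p \<in> S1" "p \<in> components e" for p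
  proof -
    define P Q where "P = (\<lambda>x. inv j (j p * j x))" and "Q = (\<lambda>x. inv j (j q * j x))"
    have P: "band_projection P" "P e = p" "\<And>x. j (P x) = j p * j x"
      unfolding P_def by (rule component_projection[OF p(2)])+
    have Q: "band_projection Q" "Q e = q" "\<And>x. j (Q x) = j q * j x"
      unfolding Q_def by (rule component_projection[OF q(2)])+
    have "T (P (Q e)) = T (Q (T (P e)))"
      using ind P(1,2) Q(1,2) p(1) q(1)
      unfolding cond_indep_subspaces_def cond_indep_projections_def by metis
    then have "T (P q) = T (Q (T p))" by (simp only: P(2) Q(2))
    then have "\<tau> (j p * j q) = \<tau> (j q * \<tau> (j p))"
      by (metis P(3) Q(3) \<tau>_j)
    then show ?thesis
      by (simp add: G_def components_one_commute[OF jq])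
  qed
  have G_bdd: "G (j y) = 0" if "y \<in> S1" "unit_bounded (j y)" for y
  proof (rule vanish_on_bounded[OF S1, where w = "2 *\<^sub>R 1"])
    fix u \<epsilon> assume u: "\<bar>u\<bar> \<le> \<epsilon> *\<^sub>R (1::'u)"
    then have uL: "u \<in> L" by (rule bounded_in_L)
    have "\<tau> \<bar>u\<bar> \<le> \<tau> (\<epsilon> *\<^sub>R 1)" using u uL by (intro \<tau>_mono L_closed)
    also have "\<dots> = \<epsilon> *\<^sub>R 1" by (simp add: \<tau>_scale \<tau>_one L_closed)
    finally have "2 *\<^sub>R \<tau> \<bar>u\<bar> \<le> 2 *\<^sub>R (\<epsilon> *\<^sub>R 1)" by (rule scaleR_left_mono) simp
    then show "\<bar>G u\<bar> \<le> \<epsilon> *\<^sub>R (2 *\<^sub>R 1)"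
      using G_bound[OF uL] by (simp add: mult.commute)
  qed (use that G_add G_scale G_comp unit_bounded_in_L in auto)
  have G_pos: "G (j y) = 0" if y: "y \<in> S1" "0 \<le> y" for y
  proof (rule truncation_vanishes[of "j y" 1 2])
    fix n :: nat
    let ?g = "sup (j y - real n *\<^sub>R 1) 0" let ?s = "inf y (real n *\<^sub>R e)"
    have "?s \<in> S1" using S1 y(1) by (simp add: riesz_subspace_def subspace_scale)
    moreover have js: "j ?s = inf (j y) (real n *\<^sub>R 1)" by (simp add: j_simps)
    moreover have "unit_bounded (j ?s)"
    proof -
      have "0 \<le> ?s" using y(2) unit_nonneg by (simp add: scaleR_nonneg_nonneg)
      then have "0 \<le> j ?s" using j_le_iff[of 0 ?s] by (simp only: j_simps)
      then show ?thesis unfolding unit_bounded_def js by (intro exI[of _ "real n"]) simp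
    qed
    ultimately have "G (j ?s) = 0" by (intro G_bdd)
    moreover have gL: "?g \<in> L" by (intro L_closed j_in_L)
    moreover have "j y = j ?s + ?g" unfolding js by (metis add.commute diff_add_cancel diff_inf_eq_pprt)
    ultimately have "G (j y) = G ?g" using G_add[OF j_in_L gL, of ?s] by simp
    then show "\<bar>G (j y)\<bar> \<le> 2 *\<^sub>R \<tau> (1 * ?g)" using G_bound[OF gL] by simp
  next
    show "0 \<le> j y" using y(2) j_le_iff[of 0 y] by (simp add: j_simps)
  qed (simp_all add: one_nonneg j_in_L)
  let ?p = "sup x 0" let ?n = "sup (- x) 0"
  have "?p \<in> S1" "?n \<in> S1"
    using S1 x by (auto simp: riesz_subspace_def subspace_0 subspace_neg)
  then have z: "G (j ?p) = 0" "G (j ?n) = 0" by (auto intro: G_pos)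
  have "x = ?p + (-1) *\<^sub>R ?n" using pprt_nprt_decomp(1)[of x] by simp
  then have "j x = j ?p + (-1) *\<^sub>R j ?n" by (metis j_simps(1,4))
  then have "G (j x) = 0"
    using z by (simp only: G_add G_scale j_in_L L_closed scaleR_zero_right add_0_right)
  then show ?thesis by (simp add: G_def)
qed

text \<open>With \<open>T x = 0\<close> the preceding lemma says that \<open>\<tau> (j x * j q) = 0\<close> for components \<open>q\<close>. The extension from
  \<open>q\<close> to \<open>y\<close> uses truncation with weight \<open>\<bar>j x\<bar>\<close>, because \<open>x\<close> need not be bounded.\<close>

lemma indep_uncorrelated:
  assumes ind: "cond_indep_subspaces e T S1 S2"
    and S1: "riesz_subspace S1" "order_closed S1" "e \<in> S1"
    and S2: "riesz_subspace S2" "order_closed S2" "e \<in> S2"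
    and x: "x \<in> S1" "T x = 0" and y: "y \<in> S2"
    and xy: "\<bar>j x\<bar> * \<bar>j y\<bar> \<in> L"
  shows "\<tau> (j x * j y) = 0"
proof -
  let ?G = "\<lambda>v. \<tau> (j x * v)"
  note xL = unit_bounded_mult_in_L(1)[OF _ j_in_L[of x]]
  have G_unit_bounded: "?G (j z) = 0" if "z \<in> S2" "unit_bounded (j z)" for z
  proof (rule vanish_on_bounded[OF S2, where w = "\<tau> \<bar>j x\<bar>"])
    fix v \<epsilon> assume v: "\<bar>v\<bar> \<le> \<epsilon> *\<^sub>R (1::'u)"
    then have xv: "j x * v \<in> L" by (intro xL) (auto simp: unit_bounded_def)
    have "\<bar>?G v\<bar> \<le> \<tau> \<bar>j x * v\<bar>" using xv by (rule \<tau>_abs)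
    also have "\<dots> \<le> \<tau> (\<epsilon> *\<^sub>R \<bar>j x\<bar>)"
      using abs_mult_bounded(1)[OF v] xv by (intro \<tau>_mono L_closed j_in_L)
    also have "\<dots> = \<epsilon> *\<^sub>R \<tau> \<bar>j x\<bar>" by (intro \<tau>_scale L_closed j_in_L)
    finally show "\<bar>?G v\<bar> \<le> \<epsilon> *\<^sub>R \<tau> \<bar>j x\<bar>" .
  next
    fix q assume "q \<in> S2" "q \<in> components e"
    then show "?G (j q) = 0"
      using indep_component[OF ind S1 x(1)] x(2) by (simp add: \<tau>_j j_simps \<tau>_zero)
  qed (use that in \<open>auto simp: distrib_left \<tau>_add \<tau>_scale xL\<close>)
  have pos: "?G (j z) = 0 \<and> j x * j z \<in> L" if z: "z \<in> S2" "0 \<le> z" "j z \<le> \<bar>j y\<bar>" for z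
  proof -
    have jz: "0 \<le> j z" using z(2) j_le_iff[of 0 z] by (simp add: j_simps)
    have xz: "\<bar>j x\<bar> * j z \<in> L"
      using jz z(3) by (intro L_ideal[OF _ xy]) (simp add: mult_left_mono)
    have in_L: "j x * v \<in> L" if v: "0 \<le> v" "v \<le> j z" for v
    proof (rule L_ideal[OF _ xz])
      have "\<bar>j x * v\<bar> \<le> \<bar>j x\<bar> * v" using abs_le_mult[of "j x" v] v(1) by simp
      also have "\<dots> \<le> \<bar>j x\<bar> * j z" using v(2) by (rule mult_left_mono) simp
      finally show "\<bar>j x * v\<bar> \<le> \<bar>j x\<bar> * j z" .
    qed
    have "?G (j z) = 0"
    proof (rule truncation_vanishes[of "j z" "\<bar>j x\<bar>" 1])
      fix n :: nat
      let ?g = "sup (j z - real n *\<^sub>R 1) 0" let ?s = "inf z (real n *\<^sub>R e)"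
      have sS: "?s \<in> S2" using S2 z(1) by (simp add: riesz_subspace_def subspace_scale)
      have js: "j ?s = inf (j z) (real n *\<^sub>R 1)" by (simp add: j_simps)
      have s0: "0 \<le> j ?s" unfolding js using jz by (simp add: one_nonneg scaleR_nonneg_nonneg)
      then have sb: "unit_bounded (j ?s)" unfolding unit_bounded_def js by (intro exI[of _ "real n"]) simp
      have g: "0 \<le> ?g" "?g \<le> j z" using truncation_error(2)[OF jz] by simp_all
      have gL: "j x * ?g \<in> L" "\<bar>j x\<bar> * ?g \<in> L"
        using in_L[OF g] g by (auto intro!: L_ideal[OF _ xz] mult_left_mono)
      have "j z = j ?s + ?g" unfolding js by (metis add.commute diff_add_cancel diff_inf_eq_pprt)
      then have "j x * j z = j x * j ?s + j x * ?g" by (metis distrib_left)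
      then have "?G (j z) = ?G (j ?s) + ?G ?g"
        using gL(1) xL[OF sb] by (simp only: \<tau>_add)
      then have "\<bar>?G (j z)\<bar> = \<bar>?G ?g\<bar>" using G_unit_bounded[OF sS sb] by simp
      also have "\<dots> \<le> \<tau> \<bar>j x * ?g\<bar>" using gL(1) by (rule \<tau>_abs)
      also have "\<dots> \<le> \<tau> (\<bar>j x\<bar> * ?g)"
        using gL abs_le_mult[of "j x" ?g] g(1) by (intro \<tau>_mono) (simp_all add: L_closed)
      finally show "\<bar>?G (j z)\<bar> \<le> 1 *\<^sub>R \<tau> (\<bar>j x\<bar> * ?g)" by simp
    qed (use jz xz in simp_all)
    then show ?thesis using in_L[OF jz] by simp
  qed
  let ?p = "sup y 0" let ?n = "sup (- y) 0"
  have S: "?p \<in> S2" "?n \<in> S2"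
    using S2 y by (auto simp: riesz_subspace_def subspace_0 subspace_neg)
  have "?p \<le> \<bar>y\<bar>" "?n \<le> \<bar>y\<bar>" by (simp_all add: abs_ge_self abs_ge_minus_self)
  then have "j ?p \<le> \<bar>j y\<bar>" "j ?n \<le> \<bar>j y\<bar>" by (simp_all only: j_le_iff flip: j_abs)
  then have pn: "?G (j ?p) = 0" "?G (j ?n) = 0" "j x * j ?p \<in> L" "j x * j ?n \<in> L"
    using pos S sup_ge2 by blast+
  have "j y = j ?p - j ?n" using pprt_nprt_decomp(1)[of y] by (metis j_simps(2))
  then have "j x * j y = j x * j ?p - j x * j ?n" by (simp only: right_diff_distrib)
  then show ?thesis using pn by (simp only: \<tau>_diff diff_0_right)
qed

section \<open>The variance of a sum\<close>

lemma \<tau>_sum: "(\<And>i. i \<in> I \<Longrightarrow> u i \<in> L) \<Longrightarrow> \<tau> (\<Sum>i\<in>I. u i) = (\<Sum>i\<in>I. \<tau> (u i)) \<and> (\<Sum>i\<in>I. u i) \<in> L"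
  by (induction I rule: infinite_finite_induct) (auto simp: \<tau>_zero \<tau>_add L_closed)

lemma j_variance: "j (variance j T x) = \<tau> (j (x - T x) * j (x - T x))"
  by (simp add: variance_def \<tau>_def power2_eq_square)

theorem variance_sum_uncorrelated:
  assumes sq: "\<And>k. k \<in> I \<Longrightarrow> j (f k - T (f k)) * j (f k - T (f k)) \<in> L"
    and unc: "\<And>i k. i \<in> I \<Longrightarrow> k \<in> I \<Longrightarrow> i \<noteq> k \<Longrightarrow>
      \<tau> (j (f i - T (f i)) * j (f k - T (f k))) = 0"
    and fin: "finite I"
  shows "variance j T (\<Sum>k\<in>I. f k) = (\<Sum>k\<in>I. variance j T (f k))"
proof -
  define g where "g k = j (f k - T (f k))" for k
  have L: "g i * g k \<in> L" if "i \<in> I" "k \<in> I" for i k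
    using square_L_mult(2) sq that unfolding g_def by blast
  have centred: "j ((\<Sum>k\<in>I. f k) - T (\<Sum>k\<in>I. f k)) = (\<Sum>k\<in>I. g k)"
    by (simp add: g_def linear_sum[OF linear_T] linear_sum[OF linear_j] flip: sum_subtractf)
  have "j (variance j T (\<Sum>k\<in>I. f k)) = \<tau> (\<Sum>i\<in>I. \<Sum>k\<in>I. g i * g k)"
    unfolding j_variance centred sum_product ..
  also have "\<dots> = (\<Sum>i\<in>I. \<Sum>k\<in>I. \<tau> (g i * g k))"
    using L by (simp add: \<tau>_sum)
  also have "\<dots> = (\<Sum>i\<in>I. \<tau> (g i * g i))"
  proof (rule sum.cong[OF refl])
    fix i assume i: "i \<in> I"
    have "(\<Sum>k\<in>I. \<tau> (g i * g k)) = (\<Sum>k\<in>I. if i = k then \<tau> (g i * g i) else 0)"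
      using unc i by (intro sum.cong) (auto simp: g_def)
    then show "(\<Sum>k\<in>I. \<tau> (g i * g k)) = \<tau> (g i * g i)"
      using fin i by simp
  qed
  also have "\<dots> = j (\<Sum>k\<in>I. variance j T (f k))"
    by (simp add: g_def j_variance linear_sum[OF linear_j])
  finally show ?thesis using inj_j by (simp add: inj_eq)
qed

end

lemma closed_riesz_span_superset: "A \<subseteq> closed_riesz_span A"
  unfolding closed_riesz_span_def by blast

theorem theorem4p2:
  fixes j :: "'a::dedekind_complete_riesz_space \<Rightarrow> 'u::universally_complete_f_algebra"
    and T :: "'a \<Rightarrow> 'a" and e :: 'a and f :: "nat \<Rightarrow> 'a" and n :: nat
  assumes "conditional_expectation T" and "strictly_positive T"
    and "weak_order_unit e" and "T e = e"
    and "universal_completion j" and "multiplication_normalised_by j e"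
    and "T_universally_complete j T"
    and "cond_indep_sequence e T f" and "\<forall>k\<ge>1. f k \<in> L2 j"
  shows "variance j T (\<Sum>k=1..n. f k) = (\<Sum>k=1..n. variance j T (f k))"
proof -
  interpret riesz_expectation j T e
    using assms(1,4,5,6) by unfold_locales (auto simp: multiplication_normalised_by_def)
  define E where "E k = closed_riesz_span ({f k} \<union> range T)" for k
  have fam: "cond_indep_family e T {1..} E"
    using assms(8) by (simp add: cond_indep_sequence_def E_def[abs_def])
  have E: "riesz_subspace (E k)" "order_closed (E k)" "range T \<subseteq> E k" if "1 \<le> k" for k
    using fam that unfolding cond_indep_family_def by auto
  have centred: "f k - T (f k) \<in> E k" if "1 \<le> k" for k
  proof -
    have "f k \<in> E k" using closed_riesz_span_superset[of "{f k} \<union> range T"] by (simp add: E_def)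
    then show ?thesis using E[OF that] by (auto simp: riesz_subspace_def intro: subspace_diff)
  qed
  have indep: "cond_indep_subspaces e T (E i) (E k)" if "1 \<le> i" "1 \<le> k" "i \<noteq> k" for i k
  proof -
    have "cond_indep_subspaces e T (closed_riesz_span (\<Union>l\<in>I1. E l)) (closed_riesz_span (\<Union>l\<in>I2. E l))"
      if "I1 \<subseteq> {1..}" "I2 \<subseteq> {1..}" "I1 \<inter> I2 = {}" for I1 I2
      using fam that unfolding cond_indep_family_def by blast
    from this[of "{i}" "{k}"] that
    have "cond_indep_subspaces e T (closed_riesz_span (E i)) (closed_riesz_span (E k))" by simp
    then show ?thesis
      using closed_riesz_span_superset[of "E i"] closed_riesz_span_superset[of "E k"]
      unfolding cond_indep_subspaces_def by auto
  qed
  have sq: "j (f k - T (f k)) * j (f k - T (f k)) \<in> L" if "1 \<le> k" for k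
  proof -
    have "j (f k) * j (f k) \<in> L"
      using assms(9) that by (simp add: L2_def L_def power2_eq_square)
    then show ?thesis
      unfolding j_simps by (intro square_L_diff square_L_expectation)
  qed
  show ?thesis
  proof (rule variance_sum_uncorrelated)
    fix i k assume "i \<in> {1..n}" "k \<in> {1..n}" "i \<noteq> k"
    then have ik: "1 \<le> i" "1 \<le> k" "i \<noteq> k" by auto
    show "\<tau> (j (f i - T (f i)) * j (f k - T (f k))) = 0"
    proof (rule indep_uncorrelated[OF indep[OF ik]])
      show "T (f i - T (f i)) = 0" by (simp add: linear_diff[OF linear_T] T_idem)
      show "\<bar>j (f i - T (f i))\<bar> * \<bar>j (f k - T (f k))\<bar> \<in> L"
        using ik by (intro square_L_mult(1) sq)
    qed (use E[OF ik(1)] E[OF ik(2)] unit_in_range centred ik in auto)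
  qed (use sq in auto)
qed

end
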